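(* Fix $b>0$. For all $G_1,G_2\in\mathcal B_b$, $$\|\mathcal D_bG_1-\mathcal D_bG_2\|_\infty\le\max_{i\in E}\frac{\lambda_i}{w+\lambda_i}\,\|G_1-G_2\|_\infty ,$$ so $\mathcal D_b$ is a strict contraction on $\mathcal B_b$. The downward passage matrix function $x\mapsto Z^{\downarrow}(x,b)$ is the unique fixed point of $\mathcal D_b$ in $\mathcal B_b$; and for every $G^{(0)}\in\mathcal B_b$ the iteration $G^{(n+1)}=\mathcal D_bG^{(n)}$ converges uniformly on $[0,\infty)$ to $Z^{\downarrow}(\cdot,b)$.
   Context: Model. Let $E=\{1,\dots,m\}$; for each $i\in E$ let $c_i>0$, $\lambda_i>0$, $p_i\in(0,1)$, and let $Q=(q_{ij})_{i,j\in E}$ be a stochastic matrix. $(X,J)$ is the Markov process on $[0,\infty)\times E$ with the following dynamics: while the phase $J$ equals $i$, the level $X$ increases linearly with slope $1/c_i$ and the next jump occurs at rate $\lambda_i$; at a jump from $(x,i)$ the process moves to $(p_i x,j)$ with probability $q_{ij}$ ($j=i$ is allowed). $\mathbb E_{x,i}$ denotes expectation given $(X(0),J(0))=(x,i)$. Fix $w>0$. Let $\tau_{\downarrow b}=\inf\{t\ge0:X(t)\le b\}$ and let $Z^{\downarrow}(x,b)$ be the matrix with entries $Z^{\downarrow}_{ij}(x,b)=\mathbb E_{x,i}[e^{-w\tau_{\downarrow b}};J(\tau_{\downarrow b})=j]$ (contribution of $\{\tau_{\downarrow b}=\infty\}$ equal to $0$), so that $Z^{\downarrow}(x,b)=I$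 for $x\le b$. For a matrix $M$, $|M|=\max_i\sum_j|M_{ij}|$. $\mathcal B_b$ is the set of bounded Borel $m\times m$ matrix-valued functions $G$ on $[0,\infty)$ with $G(x)=I$ for $x\le b$, with the metric induced by $\|G\|_\infty=\sup_{x\ge0}|G(x)|$. The first-jump operator $\mathcal D_b$ on $\mathcal B_b$ is $$(\mathcal D_bG)_{ij}(x)=\begin{cases}\displaystyle\sum_{k=1}^m q_{ik}\int_0^\infty\lambda_ie^{-(w+\lambda_i)t}\,G_{kj}\big(p_i(x+t/c_i)\big)\,dt,&x>b,\\[2mm] \delta_{ij},&x\le b.\end{cases}$$ *)

theory Defs
  imports "HOL-Probability.Probability"
begin

(* The process (X, J) started from (x, i), on the probability space M.
   S n is the time of the n-th jump (S 0 = 0), jumps with unchanged phase included, and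
   K n the phase on [S n, S (Suc n)).  The last conjunct is the joint law of holding times and phases:
   given the past, the n-th holding time is exponential with rate lam (K n), and the next phase
   is drawn, independently of the holding time, from row K n of Q.
   Since the rates are bounded, S n tends to infinity almost surely; demanding it, like
   positivity of the holding times, on every path makes X t and J t meaningful for all t. *)
definition growth_collapse_process ::
  "('m::finite \<Rightarrow> real) \<Rightarrow> ('m \<Rightarrow> real) \<Rightarrow> ('m \<Rightarrow> real) \<Rightarrow> real^'m^'m \<Rightarrow> real \<Rightarrow> 'm \<Rightarrow>
    'w measure \<Rightarrow> (real \<Rightarrow> 'w \<Rightarrow> real) \<Rightarrow> (real \<Rightarrow> 'w \<Rightarrow> 'm) \<Rightarrow> bool" where
  "growth_collapse_process c lam p Q x i M X J \<longleftrightarrow>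
     prob_space M \<and>
     (\<forall>t\<ge>0. X t \<in> borel_measurable M \<and> J t \<in> M \<rightarrow>\<^sub>M count_space UNIV) \<and>
     (\<forall>\<omega>\<in>space M. \<forall>t\<ge>0. X t \<omega> \<ge> 0) \<and>
     (AE \<omega> in M. X 0 \<omega> = x \<and> J 0 \<omega> = i) \<and>
     (\<exists>S K.
        (\<forall>n::nat. S n \<in> borel_measurable M \<and> K n \<in> M \<rightarrow>\<^sub>M count_space UNIV) \<and>
        (\<forall>\<omega>\<in>space M.
           S 0 \<omega> = 0 \<and>
           (\<forall>n. S n \<omega> < S (Suc n) \<omega>) \<and>
           filterlim (\<lambda>n. S n \<omega>) at_top sequentially \<and>
           (\<forall>n t. S n \<omega> \<le> t \<and> t < S (Suc n) \<omega> \<longrightarrow>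
              J t \<omega> = K n \<omega> \<and>
              X t \<omega> = X (S n \<omega>) \<omega> + (t - S n \<omega>) / c (K n \<omega>)) \<and>
           (\<forall>n. X (S (Suc n) \<omega>) \<omega> =
              p (K n \<omega>) * (X (S n \<omega>) \<omega> + (S (Suc n) \<omega> - S n \<omega>) / c (K n \<omega>)))) \<and>
        (\<forall>n s j. (\<forall>k<n. s k \<ge> 0) \<and> j 0 = i \<longrightarrow>
           measure M {\<omega> \<in> space M. \<forall>k<n.
               S (Suc k) \<omega> - S k \<omega> > s k \<and> K (Suc k) \<omega> = j (Suc k)} =
           (\<Prod>k<n. exp (- lam (j k) * s k) * Q $ j k $ j (Suc k))))"

definition down_time :: "(real \<Rightarrow> 'w \<Rightarrow> real) \<Rightarrow> real \<Rightarrow> 'w \<Rightarrow> ereal" where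
  "down_time X b \<omega> = (INF t\<in>{t. 0 \<le> t \<and> X t \<omega> \<le> b}. ereal t)"

(* Functions on the half-line are represented as extensional functions on {0..}. *)
definition Z_down ::
  "(real \<Rightarrow> 'm \<Rightarrow> 'w measure) \<Rightarrow> (real \<Rightarrow> 'w \<Rightarrow> real) \<Rightarrow> (real \<Rightarrow> 'w \<Rightarrow> 'm::finite) \<Rightarrow>
    real \<Rightarrow> real \<Rightarrow> real \<Rightarrow> real^'m^'m" where
  "Z_down P X J w b = (\<lambda>x\<in>{0..}. \<chi> i j.
     (\<integral>\<omega>. (if down_time X b \<omega> = \<infinity> then 0
           else exp (- w * real_of_ereal (down_time X b \<omega>)) *
                of_bool (J (real_of_ereal (down_time X b \<omega>)) \<omega> = j)) \<partial>P x i))"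

definition mat_norm :: "real^'m^'m::finite \<Rightarrow> real" where
  "mat_norm A = (MAX i. \<Sum>j\<in>UNIV. \<bar>A $ i $ j\<bar>)"

definition fun_norm :: "(real \<Rightarrow> real^'m^'m::finite) \<Rightarrow> real" where
  "fun_norm G = (SUP x\<in>{0..}. mat_norm (G x))"

definition passage_funs :: "real \<Rightarrow> (real \<Rightarrow> real^'m^'m::finite) set" where
  "passage_funs b = {G \<in> extensional {0..}.
     G \<in> borel_measurable (restrict_space borel {0..}) \<and>
     bounded (G ` {0..}) \<and>
     (\<forall>x. 0 \<le> x \<and> x \<le> b \<longrightarrow> G x = mat 1)}"

definition first_jump_op ::
  "('m::finite \<Rightarrow> real) \<Rightarrow> ('m \<Rightarrow> real) \<Rightarrow> ('m \<Rightarrow> real) \<Rightarrow> real^'m^'m \<Rightarrow> real \<Rightarrow> real \<Rightarrow>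
    (real \<Rightarrow> real^'m^'m) \<Rightarrow> real \<Rightarrow> real^'m^'m" where
  "first_jump_op c lam p Q w b G = (\<lambda>x\<in>{0..}.
     if x > b then
       \<chi> i j. \<Sum>k\<in>UNIV. Q $ i $ k *
         (LBINT t:{0..}. lam i * exp (- (w + lam i) * t) * G (p i * (x + t / c i)) $ k $ j)
     else mat 1)"

end

theory Submission
  imports Defs
begin

text \<open>Between jumps the level increases, so level \<open>b\<close> can only be reached at a jump. Let \<open>N\<close> be the first
  jump after which the level is at most \<open>b\<close>. By induction on \<open>n\<close>, the \<open>n\<close>-th iterate of the first-jump
  operator on \<open>G\<close>, evaluated at \<open>x\<close>, is the expected discounted value of \<open>G\<close> at jump \<open>min n N\<close>
  of the process started at \<open>x\<close>. Since the iterate of order \<open>n + 1\<close> on \<open>G\<close> is the one of order \<open>n\<close> applied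
  to the image of \<open>G\<close>, the induction changes only the last jump: it needs the exponential law of one
  holding time given the past, under a single law, and no Markov property relating different starting
  points. Letting \<open>n\<close> tend to infinity identifies the pointwise limit of the iterates as the passage
  function; contraction makes the convergence uniform and the limit a fixed point.\<close>

section \<open>Passage functions\<close>

text \<open>Each \<open>P x i\<close> is a separate measure, and nothing says how it varies with
  \<open>x\<close>. So neither Borel measurability of the passage function in \<open>x\<close> nor
  its fixed point equation can be read off by conditioning on the first jump. Both are inherited
  from the iterates, whose limit at each \<open>x\<close> is computed under the law
  \<open>P x i\<close> alone. The constant \<open>lam i / (w + lam i)\<close> is the expectation of
  \<open>exp (- w * T)\<close> for \<open>T\<close> exponential with rate \<open>lam i\<close>: the
  discount spent on one holding time. The joint law is given only as products of tails and
  transition probabilities for finitely many jumps. A pi-system argument turns these products into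
  independence of the next holding time and phase from the whole past, given the current
  phase.\<close>

lemma mat_norm_row: "(\<Sum>j\<in>UNIV. \<bar>A $ i $ j\<bar>) \<le> mat_norm A"
  unfolding mat_norm_def by (intro Max_ge) auto

lemma mat_norm_leI: "(\<And>i. (\<Sum>j\<in>UNIV. \<bar>A $ i $ j\<bar>) \<le> C) \<Longrightarrow> mat_norm A \<le> C"
  unfolding mat_norm_def by (intro Max.boundedI) auto

lemma mat_norm_nonneg: "0 \<le> mat_norm A"
  using mat_norm_row[of A undefined] by (meson order_trans sum_nonneg abs_ge_zero)

lemma abs_entry_le_mat_norm: "\<bar>A $ i $ j\<bar> \<le> mat_norm A"
  using mat_norm_row[of A i] member_le_sum[of j UNIV "\<lambda>j. \<bar>A $ i $ j\<bar>"] by auto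

text \<open>\<open>bounded\<close> and \<open>uniform_limit\<close> refer to the Euclidean norm, the
  contraction to the maximal row sum. This crude comparison carries the bounds over and shows that
  \<open>mat_norm\<close> vanishes only at zero.\<close>

lemma norm_le_card_mat_norm: "norm (A :: real^'m^'m::finite) \<le> real CARD('m) * mat_norm A"
proof -
  have "norm A \<le> (\<Sum>i\<in>UNIV. norm (A $ i))"
    by (simp add: norm_vec_def[of A] L2_set_le_sum)
  also have "\<dots> \<le> (\<Sum>i\<in>(UNIV::'m set). mat_norm A)"
    by (intro sum_mono order_trans[OF norm_le_l1_cart mat_norm_row])
  finally show ?thesis by simp
qed

lemma mat_norm_triangle: "mat_norm (A + B) \<le> mat_norm A + mat_norm B"
proof (rule mat_norm_leI)
  fix i
  have "(\<Sum>j\<in>UNIV. \<bar>(A + B) $ i $ j\<bar>) \<le> (\<Sum>j\<in>UNIV. \<bar>A $ i $ j\<bar>) + (\<Sum>j\<in>UNIV. \<bar>B $ i $ j\<bar>)"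
    by (simp add: sum.distrib[symmetric] sum_mono abs_triangle_ineq)
  then show "(\<Sum>j\<in>UNIV. \<bar>(A + B) $ i $ j\<bar>) \<le> mat_norm A + mat_norm B"
    using mat_norm_row[of A i] mat_norm_row[of B i] by linarith
qed

lemma mat_norm_uminus [simp]: "mat_norm (- A) = mat_norm A"
  by (simp add: mat_norm_def)

lemma mat_norm_zero [simp]: "mat_norm 0 = 0"
  by (simp add: mat_norm_def)

lemma mat_norm_one [simp]: "mat_norm (mat 1 :: real^'m^'m::finite) = 1"
proof -
  have "(\<Sum>j\<in>UNIV. \<bar>(mat 1 :: real^'m^'m::finite) $ i $ j\<bar>) = 1" for i
    by (simp add: mat_def if_distrib[of abs] cong: if_cong)
  then show ?thesis unfolding mat_norm_def by simp
qed

lemma passage_funs_bound: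
  fixes G :: "real \<Rightarrow> real^'m^'m::finite"
  assumes "G \<in> passage_funs b"
  obtains B where "\<And>x. 0 \<le> x \<Longrightarrow> mat_norm (G x) \<le> B"
proof -
  from assms obtain B where B: "\<And>x. 0 \<le> x \<Longrightarrow> norm (G x) \<le> B"
    by (auto simp: passage_funs_def bounded_iff)
  have "mat_norm (G x) \<le> real CARD('m) * B" if "0 \<le> x" for x
  proof (rule mat_norm_leI)
    fix i :: 'm
    have "(\<Sum>j\<in>UNIV. \<bar>G x $ i $ j\<bar>) \<le> (\<Sum>j\<in>(UNIV::'m set). B)"
      using component_le_norm_cart[of "G x $ i"] Finite_Cartesian_Product.norm_nth_le[of "G x" i] B[OF that]
      by (intro sum_mono) (meson order_trans)
    then show "(\<Sum>j\<in>UNIV. \<bar>G x $ i $ j\<bar>) \<le> real CARD('m) * B" by simp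
  qed
  then show ?thesis by (rule that)
qed

lemma passage_funs_eq_mat1: "G \<in> passage_funs b \<Longrightarrow> 0 \<le> x \<Longrightarrow> x \<le> b \<Longrightarrow> G x = mat 1"
  by (simp add: passage_funs_def)

text \<open>Extension by zero, so that entries become Borel functions on the whole line.\<close>

definition entry0 :: "(real \<Rightarrow> real^'m^'m::finite) \<Rightarrow> 'm \<Rightarrow> 'm \<Rightarrow> real \<Rightarrow> real" where
  "entry0 G k j y = (if 0 \<le> y then G y $ k $ j else 0)"

lemma entry0_eq: "0 \<le> y \<Longrightarrow> entry0 G k j y = G y $ k $ j"
  by (simp add: entry0_def)

lemma measurable_entry0:
  assumes "G \<in> passage_funs b"
  shows "entry0 G k j \<in> borel_measurable borel"
proof -
  have "(\<lambda>y. G y $ k $ j) \<in> borel_measurable (restrict_space borel {0..})"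
    using assms unfolding passage_funs_def
    by (auto intro!: measurable_compose[of G _ borel] borel_measurable_continuous_onI continuous_intros)
  then have "(\<lambda>y. if y \<in> {0..} then G y $ k $ j else 0) \<in> borel_measurable borel"
    by (subst (asm) measurable_restrict_space_iff[where c=0]) auto
  then show ?thesis by (simp add: entry0_def[abs_def])
qed

text \<open>A real \<open>SUP\<close> says nothing about an unbounded set; this makes
  \<open>fun_norm\<close> of a difference an actual upper bound.\<close>

lemma passage_funs_diff_bdd:
  assumes "G1 \<in> passage_funs b" "G2 \<in> passage_funs b"
  shows "bdd_above ((\<lambda>x. mat_norm (G1 x - G2 x)) ` {0..})"
proof -
  obtain B1 B2 where "\<And>x. 0 \<le> x \<Longrightarrow> mat_norm (G1 x) \<le> B1" "\<And>x. 0 \<le> x \<Longrightarrow> mat_norm (G2 x) \<le> B2"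
    using assms passage_funs_bound by metis
  then have "mat_norm (G1 x - G2 x) \<le> B1 + B2" if "0 \<le> x" for x
    using mat_norm_triangle[of "G1 x" "- G2 x"] that by (simp add: add_mono order_trans)
  then show ?thesis by (intro bdd_aboveI2) auto
qed

lemma mat_norm_diff_le_fun_norm:
  assumes "G1 \<in> passage_funs b" "G2 \<in> passage_funs b" "0 \<le> x"
  shows "mat_norm (G1 x - G2 x) \<le> fun_norm (\<lambda>x. G1 x - G2 x)"
  unfolding fun_norm_def
  by (intro cSUP_upper passage_funs_diff_bdd[OF assms(1,2)]) (use assms in auto)

lemma fun_norm_leI: "(\<And>x. 0 \<le> x \<Longrightarrow> mat_norm (G x) \<le> C) \<Longrightarrow> fun_norm G \<le> C"
  unfolding fun_norm_def by (intro cSUP_least) auto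

section \<open>The first-jump operator\<close>

locale growth_collapse_data =
  fixes c lam p :: "'m::finite \<Rightarrow> real" and Q :: "real^'m^'m" and w b :: real
  assumes c_pos: "\<And>i. c i > 0" and lam_pos: "\<And>i. lam i > 0"
    and p_bounds: "\<And>i. 0 < p i \<and> p i < 1"
    and Q_nonneg: "\<And>i j. Q $ i $ j \<ge> 0" and Q_row: "\<And>i. (\<Sum>j\<in>UNIV. Q $ i $ j) = 1"
    and w_pos: "w > 0" and b_pos: "b > 0"
begin

abbreviation D :: "(real \<Rightarrow> real^'m^'m) \<Rightarrow> real \<Rightarrow> real^'m^'m" where
  "D \<equiv> first_jump_op c lam p Q w b"

section \<open>The contraction constant and expectations discounted over one holding time\<close>

definition rho :: real where "rho = (MAX i. lam i / (w + lam i))"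

lemma rho_ge: "lam i / (w + lam i) \<le> rho"
  unfolding rho_def by (intro Max_ge) auto

lemma rho_less_1: "rho < 1"
  unfolding rho_def using lam_pos w_pos by (subst Max_less_iff) (auto simp: add_pos_pos)

lemma rho_nonneg: "0 \<le> rho"
  by (rule order_trans[OF _ rho_ge[of undefined]]) (use lam_pos w_pos in \<open>simp add: less_imp_le\<close>)

text \<open>Density of the holding time in phase \<open>i\<close> times the discount
  \<open>exp (- w * t)\<close>, cut off at negative times so that integrals can run over the whole
  line.\<close>

definition disc :: "'m \<Rightarrow> real \<Rightarrow> real" where
  "disc i t = indicator {0..} t * (lam i * exp (- (w + lam i) * t))"

text \<open>Expected discounted value of \<open>F\<close> at the level just after the first jump
  from level \<open>x\<close> in phase \<open>i\<close>.\<close>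

definition discounted :: "'m \<Rightarrow> (real \<Rightarrow> real) \<Rightarrow> real \<Rightarrow> real" where
  "discounted i F x = (\<integral>t. disc i t * F (p i * (x + t / c i)) \<partial>lborel)"

lemma measurable_disc [measurable]: "disc i \<in> borel_measurable borel"
  unfolding disc_def[abs_def] by measurable

lemma disc_nonneg: "0 \<le> disc i t"
  using lam_pos[of i] by (simp add: disc_def)

text \<open>\<open>disc i\<close> is \<open>lam i / (w + lam i)\<close> times the probability
  density of the exponential law of rate \<open>w + lam i\<close>. The contraction constant
  originates here.\<close>

lemma has_bochner_integral_disc: "has_bochner_integral lborel (disc i) (lam i / (w + lam i))"
proof -
  have pos: "0 < w + lam i" using lam_pos[of i] w_pos by simp
  then interpret E: prob_space "density lborel (exponential_density (w + lam i))"
    by (rule prob_space_exponential_density)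
  have "integrable (density lborel (exponential_density (w + lam i))) (\<lambda>_. 1 :: real)" by simp
  moreover have "(\<integral>t. 1 \<partial>density lborel (exponential_density (w + lam i))) = (1 :: real)"
    using E.prob_space by simp
  ultimately have "has_bochner_integral lborel (exponential_density (w + lam i)) 1"
    using exponential_density_nonneg[OF pos]
    by (subst (asm) integrable_density, simp_all, subst (asm) integral_density) (simp_all add: has_bochner_integral_iff)
  from has_bochner_integral_mult_right[OF this, of "lam i / (w + lam i)"]
  have "has_bochner_integral lborel (\<lambda>t. lam i / (w + lam i) * exponential_density (w + lam i) t) (lam i / (w + lam i))"
    by simp
  moreover have "lam i / (w + lam i) * exponential_density (w + lam i) t = disc i t" for t
  proof -
    have "- t * (w + lam i) = - (w + lam i) * t" by (simp add: algebra_simps)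
    then show ?thesis using pos unfolding exponential_density_def disc_def by simp
  qed
  ultimately show ?thesis by simp
qed

lemma integrable_discounted:
  assumes [measurable]: "F \<in> borel_measurable borel" and F: "\<And>y. \<bar>F y\<bar> \<le> C"
  shows "integrable lborel (\<lambda>t. disc i t * F (p i * (x + t / c i)))"
proof (rule Bochner_Integration.integrable_bound)
  show "integrable lborel (\<lambda>t. disc i t * C)"
    using has_bochner_integral_disc[of i] by (intro integrable_mult_left) (auto simp: has_bochner_integral_iff)
  have "0 \<le> C" using F[of 0] by linarith
  then show "AE t in lborel. norm (disc i t * F (p i * (x + t / c i))) \<le> norm (disc i t * C)"
    using F by (auto simp: abs_mult intro!: mult_left_mono)
qed measurable

lemma discounted_abs_le: "\<bar>discounted i F x\<bar> \<le> discounted i (\<lambda>y. \<bar>F y\<bar>) x"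
  unfolding discounted_def
  using integral_abs_bound[of lborel "\<lambda>t. disc i t * F (p i * (x + t / c i))"]
  by (simp add: abs_mult disc_nonneg)

lemma discounted_sum:
  assumes "\<And>j. j \<in> I \<Longrightarrow> F j \<in> borel_measurable borel" "\<And>j y. j \<in> I \<Longrightarrow> \<bar>F j y\<bar> \<le> C"
  shows "discounted i (\<lambda>y. \<Sum>j\<in>I. F j y) x = (\<Sum>j\<in>I. discounted i (F j) x)"
  unfolding discounted_def sum_distrib_left
  by (intro Bochner_Integration.integral_sum integrable_discounted[where C=C] assms)

lemma discounted_diff:
  assumes "F1 \<in> borel_measurable borel" "F2 \<in> borel_measurable borel" "\<And>y. \<bar>F1 y\<bar> \<le> C1" "\<And>y. \<bar>F2 y\<bar> \<le> C2"
  shows "discounted i (\<lambda>y. F1 y - F2 y) x = discounted i F1 x - discounted i F2 x"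
  unfolding discounted_def right_diff_distrib
  using integrable_discounted[OF assms(1,3)] integrable_discounted[OF assms(2,4)]
  by (rule Bochner_Integration.integral_diff)

lemma discounted_le:
  assumes "F \<in> borel_measurable borel" "\<And>y. \<bar>F y\<bar> \<le> C"
  shows "discounted i F x \<le> lam i / (w + lam i) * C"
proof -
  note C = has_bochner_integral_mult_left[OF has_bochner_integral_disc[of i], of C]
  have "discounted i F x \<le> (\<integral>t. disc i t * C \<partial>lborel)"
    unfolding discounted_def
    by (intro integral_mono integrable_discounted[OF assms] integrable.intros[OF C] mult_left_mono disc_nonneg)
       (use assms(2) in \<open>simp add: abs_le_iff\<close>)
  then show ?thesis
    using has_bochner_integral_integral_eq[OF C] by simp
qed

lemma measurable_discounted:
  assumes [measurable]: "F \<in> borel_measurable borel"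
  shows "discounted i F \<in> borel_measurable borel"
  unfolding discounted_def[abs_def] by measurable

text \<open>The sums over \<open>j\<close> and \<open>k\<close> are exchanged before estimating, so
  that the integral sees a whole row of \<open>F k\<close> at once; estimating entry by entry would
  cost a factor and destroy the contraction. The rows of \<open>Q\<close> then average the bound.
  Serves both the size of \<open>D G\<close> and differences.\<close>

lemma discounted_row_sum_le:
  fixes F :: "'m \<Rightarrow> 'm \<Rightarrow> real \<Rightarrow> real"
  assumes meas: "\<And>k j. F k j \<in> borel_measurable borel" and F: "\<And>k y. (\<Sum>j\<in>UNIV. \<bar>F k j y\<bar>) \<le> C"
  shows "(\<Sum>j\<in>UNIV. \<bar>\<Sum>k\<in>UNIV. Q $ i $ k * discounted i (F k j) x\<bar>) \<le> rho * C"
proof -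
  have F1: "\<bar>F k j y\<bar> \<le> C" for k j y

    using member_le_sum[of j UNIV "\<lambda>j. \<bar>F k j y\<bar>"] F[of k y] by (simp del: sum_abs)
  have [measurable]: "(\<lambda>y. \<bar>F k j y\<bar>) \<in> borel_measurable borel" for k j using meas by measurable
  have "(\<Sum>j\<in>UNIV. \<bar>\<Sum>k\<in>UNIV. Q $ i $ k * discounted i (F k j) x\<bar>)
      \<le> (\<Sum>j\<in>UNIV. \<Sum>k\<in>UNIV. Q $ i $ k * discounted i (\<lambda>y. \<bar>F k j y\<bar>) x)"
    using discounted_abs_le Q_nonneg
    by (intro sum_mono order_trans[OF sum_abs]) (simp add: abs_mult mult_left_mono)
  also have "\<dots> = (\<Sum>k\<in>UNIV. Q $ i $ k * discounted i (\<lambda>y. \<Sum>j\<in>UNIV. \<bar>F k j y\<bar>) x)"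
    using F1 by (subst sum.swap) (simp add: discounted_sum[where C=C] sum_distrib_left)
  also have "\<dots> \<le> (\<Sum>k\<in>UNIV. Q $ i $ k * (lam i / (w + lam i) * C))"
    using F by (intro sum_mono mult_left_mono discounted_le Q_nonneg) (auto simp: abs_of_nonneg sum_nonneg)
  also have "\<dots> = lam i / (w + lam i) * C"
    unfolding sum_distrib_right[symmetric] Q_row by simp
  also have "\<dots> \<le> rho * C"
    using F1[of undefined undefined 0] by (intro mult_right_mono rho_ge) auto
  finally show ?thesis .
qed

section \<open>Bounds, contraction and invariance for the operator\<close>

lemma D_le: "0 \<le> x \<Longrightarrow> x \<le> b \<Longrightarrow> D G x = mat 1"
  by (simp add: first_jump_op_def)

text \<open>For \<open>t \<ge> 0\<close> the level \<open>p i * (x + t / c i)\<close> is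
  nonnegative, so the extension by zero changes nothing where \<open>disc i\<close> is
  nonzero.\<close>

lemma D_gt:
  assumes "b < x"
  shows "D G x $ i $ j = (\<Sum>k\<in>UNIV. Q $ i $ k * discounted i (entry0 G k j) x)"
proof -
  have x: "0 \<le> x" using assms b_pos by simp
  have "(LBINT t:{0..}. lam i * exp (- (w + lam i) * t) * G (p i * (x + t / c i)) $ k $ j) =
      discounted i (entry0 G k j) x" for k
    unfolding discounted_def set_lebesgue_integral_def disc_def
  proof (rule Bochner_Integration.integral_cong[OF refl])
    fix t
    have "0 \<le> p i * (x + t / c i)" if "0 \<le> t"
      using x that c_pos[of i] p_bounds[of i] by simp
    then show "indicat_real {0..} t *\<^sub>R (lam i * exp (- (w + lam i) * t) * G (p i * (x + t / c i)) $ k $ j) =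
      indicat_real {0..} t * (lam i * exp (- (w + lam i) * t)) * entry0 G k j (p i * (x + t / c i))"
      by (auto simp: indicator_def entry0_eq)
  qed
  then show ?thesis using assms x by (simp add: first_jump_op_def)
qed

lemma entry0_row_le:
  assumes "\<And>x. 0 \<le> x \<Longrightarrow> mat_norm (G x) \<le> C"
  shows "(\<Sum>j\<in>UNIV. \<bar>entry0 G k j y\<bar>) \<le> C"
proof (cases "0 \<le> y")
  case True
  then show ?thesis using assms[of y] mat_norm_row[of "G y" k] by (simp add: entry0_def)
next
  case False
  then show ?thesis using assms[of 0] mat_norm_nonneg[of "G 0"] by (simp add: entry0_def)
qed

lemma entry0_le:
  assumes "\<And>x. 0 \<le> x \<Longrightarrow> mat_norm (G x) \<le> C"
  shows "\<bar>entry0 G k j y\<bar> \<le> C"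
  using entry0_row_le[OF assms] member_le_sum[of j UNIV "\<lambda>j. \<bar>entry0 G k j y\<bar>"]
  by (meson order_trans UNIV_I finite abs_ge_zero)

text \<open>The bound \<open>B\<close> is kept exactly, so that one constant serves all
  iterates.\<close>

lemma mat_norm_D_le:
  assumes G: "G \<in> passage_funs b" and B: "\<And>x. 0 \<le> x \<Longrightarrow> mat_norm (G x) \<le> B" and x: "0 \<le> x"
  shows "mat_norm (D G x) \<le> B"
proof (cases "x \<le> b")
  case True
  \<comment> \<open>\<open>B \<ge> 1\<close>, because \<open>G 0\<close> is the identity when
    \<open>b\<close> is positive.\<close>
  then show ?thesis using B[of 0] passage_funs_eq_mat1[OF G, of 0] b_pos by (simp add: D_le x)
next
  case False
  have "0 \<le> B" using B[of 0] mat_norm_nonneg[of "G 0"] by simp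
  then have "rho * B \<le> B" using rho_less_1 by (simp add: mult_left_le_one_le rho_nonneg)
  moreover have "(\<Sum>j\<in>UNIV. \<bar>\<Sum>k\<in>UNIV. Q $ i $ k * discounted i (entry0 G k j) x\<bar>) \<le> rho * B" for i
    by (intro discounted_row_sum_le measurable_entry0[OF G] entry0_row_le B)
  ultimately show ?thesis
    using False by (intro mat_norm_leI) (auto simp: D_gt intro: order_trans)
qed

text \<open>A pointwise bound \<open>C\<close> in place of \<open>fun_norm\<close> allows iteration
  by induction. At levels up to \<open>b\<close> the two images coincide; above, the row estimate is
  applied to the difference of the integrands.\<close>

lemma mat_norm_D_diff_le:
  assumes G: "G1 \<in> passage_funs b" "G2 \<in> passage_funs b"
    and C: "\<And>x. 0 \<le> x \<Longrightarrow> mat_norm (G1 x - G2 x) \<le> C" and x: "0 \<le> x"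
  shows "mat_norm (D G1 x - D G2 x) \<le> rho * C"
proof (cases "x \<le> b")
  case True
  have "0 \<le> C" using C[of 0] mat_norm_nonneg[of "G1 0 - G2 0"] by simp
  then show ?thesis using True by (simp add: D_le x rho_nonneg)
next
  case False
  obtain B1 where B1: "\<And>x. 0 \<le> x \<Longrightarrow> mat_norm (G1 x) \<le> B1" using passage_funs_bound[OF G(1)] by blast
  obtain B2 where B2: "\<And>x. 0 \<le> x \<Longrightarrow> mat_norm (G2 x) \<le> B2" using passage_funs_bound[OF G(2)] by blast
  note [measurable] = measurable_entry0[OF G(1)] measurable_entry0[OF G(2)]
  have "entry0 G1 k j y - entry0 G2 k j y = entry0 (\<lambda>x. G1 x - G2 x) k j y" for k j y
    by (simp add: entry0_def)
  then have "(\<Sum>j\<in>UNIV. \<bar>entry0 G1 k j y - entry0 G2 k j y\<bar>) \<le> C" for k y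
    using entry0_row_le[of "\<lambda>x. G1 x - G2 x", OF C] by simp
  then have "(\<Sum>j\<in>UNIV. \<bar>\<Sum>k\<in>UNIV. Q $ i $ k * discounted i (\<lambda>y. entry0 G1 k j y - entry0 G2 k j y) x\<bar>) \<le> rho * C" for i
    by (intro discounted_row_sum_le) auto
  moreover have "(D G1 x - D G2 x) $ i $ j =
      (\<Sum>k\<in>UNIV. Q $ i $ k * discounted i (\<lambda>y. entry0 G1 k j y - entry0 G2 k j y) x)" for i j
    using False entry0_le[OF B1] entry0_le[OF B2]
    by (subst discounted_diff) (auto simp: D_gt right_diff_distrib sum_subtractf)
  ultimately show ?thesis by (intro mat_norm_leI) simp
qed

lemma bounded_if_mat_norm_le:
  fixes G :: "real \<Rightarrow> real^'m^'m"
  assumes "\<And>x. 0 \<le> x \<Longrightarrow> mat_norm (G x) \<le> B"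
  shows "bounded (G ` {0..})"
  unfolding bounded_iff
proof (intro exI ballI)
  fix y assume "y \<in> G ` {0..}"
  then obtain x where "0 \<le> x" "y = G x" by auto
  then show "norm y \<le> real CARD('m) * B"
    using assms norm_le_card_mat_norm[of "G x"] by (meson mult_left_mono of_nat_0_le_iff order_trans)
qed

lemma measurable_matrixI:
  fixes G :: "real \<Rightarrow> real^'m^'m"
  assumes "\<And>i j. (\<lambda>x. G x $ i $ j) \<in> borel_measurable N"
  shows "G \<in> N \<rightarrow>\<^sub>M borel"
  using assms by (subst borel_measurable_euclidean_space) (auto simp: Basis_vec_def inner_axis)

lemma D_passage_funs:
  assumes G: "G \<in> passage_funs b"
  shows "D G \<in> passage_funs b"
proof -
  obtain B where B: "\<And>x. 0 \<le> x \<Longrightarrow> mat_norm (G x) \<le> B"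
    using passage_funs_bound[OF G] by blast
  have "D G \<in> restrict_space borel {0..} \<rightarrow>\<^sub>M borel"
  proof (rule measurable_matrixI)
    fix i j
    note [measurable] = measurable_discounted[OF measurable_entry0[OF G]]
    have "(\<lambda>x. if b < x then \<Sum>k\<in>UNIV. Q $ i $ k * discounted i (entry0 G k j) x else mat 1 $ i $ j)
        \<in> borel_measurable (restrict_space borel {0..})"
      by (intro measurable_restrict_space1) measurable
    then show "(\<lambda>x. D G x $ i $ j) \<in> borel_measurable (restrict_space borel {0..})"
      by (rule measurable_cong[THEN iffD1, rotated])
         (auto simp: space_restrict_space D_gt D_le not_less)
  qed
  moreover have "D G \<in> extensional {0..}" by (simp add: first_jump_op_def)
  ultimately show ?thesis
    using bounded_if_mat_norm_le[of "D G", OF mat_norm_D_le[OF G B]]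
    by (auto simp: passage_funs_def D_le)
qed

section \<open>Iteration, uniqueness and the uniform limit\<close>

lemma funpow_D_passage_funs: "G \<in> passage_funs b \<Longrightarrow> (D ^^ n) G \<in> passage_funs b"
  by (induction n) (auto intro: D_passage_funs)

lemma mat_norm_funpow_D_le:
  assumes "G \<in> passage_funs b" "\<And>x. 0 \<le> x \<Longrightarrow> mat_norm (G x) \<le> B" "0 \<le> x"
  shows "mat_norm ((D ^^ n) G x) \<le> B"
  using assms(3)
proof (induction n arbitrary: x)
  case (Suc n)
  from mat_norm_D_le[OF funpow_D_passage_funs[OF assms(1)] Suc.IH] Suc.prems show ?case by simp
qed (use assms in simp)

lemma mat_norm_funpow_D_diff_le:
  assumes "G1 \<in> passage_funs b" "G2 \<in> passage_funs b"
    "\<And>x. 0 \<le> x \<Longrightarrow> mat_norm (G1 x - G2 x) \<le> C" "0 \<le> x"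
  shows "mat_norm ((D ^^ n) G1 x - (D ^^ n) G2 x) \<le> rho ^ n * C"
  using assms(4)
proof (induction n arbitrary: x)
  case (Suc n)
  from mat_norm_D_diff_le[OF funpow_D_passage_funs[OF assms(1)] funpow_D_passage_funs[OF assms(2)] Suc.IH] Suc.prems
  show ?case by (simp add: mult.assoc)
qed (use assms in simp)

lemma fun_norm_D_diff_le:
  assumes "G1 \<in> passage_funs b" "G2 \<in> passage_funs b"
  shows "fun_norm (\<lambda>x. D G1 x - D G2 x) \<le> rho * fun_norm (\<lambda>x. G1 x - G2 x)"
  by (intro fun_norm_leI mat_norm_D_diff_le mat_norm_diff_le_fun_norm[OF assms] assms)

lemma D_fixed_point_unique:
  assumes G: "G1 \<in> passage_funs b" "G2 \<in> passage_funs b" and fixed: "D G1 = G1" "D G2 = G2"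
  shows "G1 = G2"
proof -
  let ?d = "fun_norm (\<lambda>x. G1 x - G2 x)"
  have "(1 - rho) * ?d \<le> 0" using fun_norm_D_diff_le[OF G] fixed by (simp add: algebra_simps)
  then have d: "?d \<le> 0" using rho_less_1 by (simp add: mult_le_0_iff)
  have "G1 x = G2 x" if "0 \<le> x" for x
  proof -
    have "mat_norm (G1 x - G2 x) \<le> 0"
      using mat_norm_diff_le_fun_norm[OF G that] d by simp
    then have "norm (G1 x - G2 x) \<le> 0"
      using norm_le_card_mat_norm[of "G1 x - G2 x"] mat_norm_nonneg[of "G1 x - G2 x"] by simp
    then show ?thesis by simp
  qed
  \<comment> \<open>Off the half-line both functions are \<open>undefined\<close> by
    extensionality.\<close>
  moreover have "G1 x = G2 x" if "\<not> 0 \<le> x" for x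
    using G that by (simp add: passage_funs_def extensional_def)
  ultimately show ?thesis by blast
qed

text \<open>Row sums are finite sums of entries, hence continuous under entrywise limits. Used with
  \<open>A\<close> an iterate, for the rate of convergence, and with \<open>A = 0\<close>, for the
  size of the limit.\<close>

lemma mat_norm_limit_le:
  fixes f :: "nat \<Rightarrow> real^'m^'m"
  assumes "\<And>i j. (\<lambda>n. f n $ i $ j) \<longlonglongrightarrow> l $ i $ j" and le: "\<And>n. mat_norm (A - f n) \<le> C"
  shows "mat_norm (A - l) \<le> C"
proof (rule mat_norm_leI)
  fix i
  have "(\<lambda>n. \<Sum>j\<in>UNIV. \<bar>(A - f n) $ i $ j\<bar>) \<longlonglongrightarrow> (\<Sum>j\<in>UNIV. \<bar>(A - l) $ i $ j\<bar>)"
    unfolding vector_minus_component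
    by (intro tendsto_sum tendsto_rabs tendsto_diff tendsto_const assms(1))
  then show "(\<Sum>j\<in>UNIV. \<bar>(A - l) $ i $ j\<bar>) \<le> C"
    by (rule LIMSEQ_le_const2) (use mat_norm_row le order_trans in blast)
qed

text \<open>The iterates are uniformly Cauchy, so that their pointwise limit is a uniform one.\<close>

context
  fixes Z :: "real \<Rightarrow> real^'m^'m"
  assumes Z_ext: "Z \<in> extensional {0..}"
    and Z_lim: "\<And>G x i j. G \<in> passage_funs b \<Longrightarrow> 0 \<le> x \<Longrightarrow> (\<lambda>n. (D ^^ n) G x $ i $ j) \<longlonglongrightarrow> Z x $ i $ j"
begin

text \<open>The iterate of order \<open>m + n\<close> is \<open>D ^^ n\<close> applied to
  \<open>(D ^^ m) G\<close>, which differs from \<open>G\<close> by at most \<open>2 * B\<close>.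
  The resulting bound does not depend on \<open>m\<close>, which then tends to infinity.\<close>

lemma mat_norm_funpow_D_diff_limit_le:
  assumes G: "G \<in> passage_funs b" and B: "\<And>x. 0 \<le> x \<Longrightarrow> mat_norm (G x) \<le> B" and x: "0 \<le> x"
  shows "mat_norm ((D ^^ n) G x - Z x) \<le> rho ^ n * (2 * B)"
proof (rule mat_norm_limit_le)
  show "(\<lambda>m. (D ^^ (m + n)) G x $ i $ j) \<longlonglongrightarrow> Z x $ i $ j" for i j
    using LIMSEQ_ignore_initial_segment[OF Z_lim[OF G x]] .
  fix m
  have "mat_norm (G y - (D ^^ m) G y) \<le> 2 * B" if "0 \<le> y" for y
    using mat_norm_triangle[of "G y" "- (D ^^ m) G y"] B[OF that] mat_norm_funpow_D_le[OF G B that, of m] by simp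
  from mat_norm_funpow_D_diff_le[OF G funpow_D_passage_funs[OF G] this x, of n]
  show "mat_norm ((D ^^ n) G x - (D ^^ (m + n)) G x) \<le> rho ^ n * (2 * B)"
    by (simp add: funpow_add add.commute[of m n])
qed

lemma funpow_D_uniform_limit:
  assumes G: "G \<in> passage_funs b"
  shows "uniform_limit {0..} (\<lambda>n. (D ^^ n) G) Z sequentially"
proof (rule uniform_limitI)
  fix e :: real assume "0 < e"
  obtain B where B: "\<And>x. 0 \<le> x \<Longrightarrow> mat_norm (G x) \<le> B"
    using passage_funs_bound[OF G] by blast
  have "(\<lambda>n. real CARD('m) * (rho ^ n * (2 * B))) \<longlonglongrightarrow> real CARD('m) * (0 * (2 * B))"
    using rho_less_1 rho_nonneg by (intro tendsto_intros LIMSEQ_realpow_zero) auto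
  then have "\<forall>\<^sub>F n in sequentially. real CARD('m) * (rho ^ n * (2 * B)) < e"
    using \<open>0 < e\<close> by (intro order_tendstoD) auto
  then show "\<forall>\<^sub>F n in sequentially. \<forall>x\<in>{0..}. dist ((D ^^ n) G x) (Z x) < e"
  proof eventually_elim
    case (elim n)
    show ?case
    proof
      fix x :: real assume "x \<in> {0..}"
      then have "mat_norm ((D ^^ n) G x - Z x) \<le> rho ^ n * (2 * B)"
        using mat_norm_funpow_D_diff_limit_le[OF G B] by simp
      then have "real CARD('m) * mat_norm ((D ^^ n) G x - Z x) \<le> real CARD('m) * (rho ^ n * (2 * B))"
        by (intro mult_left_mono) auto
      with norm_le_card_mat_norm[of "(D ^^ n) G x - Z x"] elim
      show "dist ((D ^^ n) G x) (Z x) < e" unfolding dist_norm by linarith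
    qed
  qed
qed

lemma passage_funs_mat1: "(\<lambda>x\<in>{0..}. mat 1 :: real^'m^'m) \<in> passage_funs b"
proof -
  have "(\<lambda>x\<in>{0..}. mat 1 :: real^'m^'m) \<in> restrict_space borel {0..} \<rightarrow>\<^sub>M borel"
    by (rule measurable_cong[THEN iffD1, OF _ measurable_const[of "mat 1"]]) (simp_all add: space_restrict_space)
  then show ?thesis by (auto simp: passage_funs_def bounded_iff)
qed

text \<open>Measurability of \<open>Z\<close> is that of a pointwise limit of iterates. They start
  from the constant identity, whose norm 1 also bounds the limit.\<close>

lemma limit_passage_funs: "Z \<in> passage_funs b"
proof -
  let ?G = "\<lambda>x\<in>{0..}. mat 1 :: real^'m^'m"
  note G = passage_funs_mat1
  have le1: "mat_norm (?G x) \<le> 1" if "0 \<le> x" for x using that by simp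
  have "mat_norm (Z x) \<le> 1" if "0 \<le> x" for x
    using mat_norm_limit_le[where f="\<lambda>n. (D ^^ n) ?G x" and A=0 and C=1, OF Z_lim[OF G that]]
      mat_norm_funpow_D_le[OF G le1 that] by simp
  then have "bounded (Z ` {0..})" by (rule bounded_if_mat_norm_le)
  moreover have "Z \<in> restrict_space borel {0..} \<rightarrow>\<^sub>M borel"
  proof (rule measurable_matrixI, rule borel_measurable_LIMSEQ_real)
    fix i j
    show "(\<lambda>n. (D ^^ n) ?G x $ i $ j) \<longlonglongrightarrow> Z x $ i $ j" if "x \<in> space (restrict_space borel {0..})" for x
      using that by (intro Z_lim G) (simp add: space_restrict_space)
    show "(\<lambda>x. (D ^^ n) ?G x $ i $ j) \<in> borel_measurable (restrict_space borel {0..})" for n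
    proof -
      have "entry0 ((D ^^ n) ?G) i j \<in> borel_measurable (restrict_space borel {0..})"
        by (intro measurable_restrict_space1 measurable_entry0[OF funpow_D_passage_funs[OF G]])
      then show ?thesis
        by (rule measurable_cong[THEN iffD1, rotated]) (simp add: entry0_eq space_restrict_space)
    qed
  qed
  moreover have "Z x = mat 1" if "0 \<le> x" "x \<le> b" for x
  proof -
    have "Z x $ i $ j = mat 1 $ i $ j" for i j
      using Z_lim[OF G that(1), of i j] passage_funs_eq_mat1[OF funpow_D_passage_funs[OF G] that]
      by (simp add: LIMSEQ_const_iff)
    then show ?thesis by (simp add: vec_eq_iff)
  qed
  ultimately show ?thesis using Z_ext by (simp add: passage_funs_def)
qed

text \<open>Both \<open>D Z\<close> and \<open>Z\<close> lie within \<open>rho ^ Suc n * 2\<close>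
  of the iterate of order \<open>Suc n\<close>: the first by contraction from the distance at order
  \<open>n\<close>, the second by the rate itself. Hence the constant 4.\<close>

lemma limit_fixed_point: "D Z = Z"
proof -
  let ?G = "\<lambda>x\<in>{0..}. mat 1 :: real^'m^'m"
  note G = passage_funs_mat1
  have "D Z x = Z x" if x: "0 \<le> x" for x
  proof -
    have le1: "mat_norm (?G x) \<le> 1" if "0 \<le> x" for x using that by simp
    have "mat_norm (D Z x - Z x) \<le> rho ^ Suc n * 4" for n
    proof -
      have 1: "mat_norm ((D ^^ n) ?G y - Z y) \<le> rho ^ n * (2 * 1)" if "0 \<le> y" for y n
        by (rule mat_norm_funpow_D_diff_limit_le[OF G le1 that])
      have "mat_norm (D ((D ^^ n) ?G) x - D Z x) \<le> rho * (rho ^ n * (2 * 1))"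
        by (rule mat_norm_D_diff_le[OF funpow_D_passage_funs[OF G] limit_passage_funs 1 x])
      then have "mat_norm (- (D ((D ^^ n) ?G) x - D Z x)) \<le> rho ^ Suc n * 2"
        unfolding mat_norm_uminus by simp
      moreover have "mat_norm (D ((D ^^ n) ?G) x - Z x) \<le> rho ^ Suc n * 2"
        using 1[OF x, of "Suc n"] by simp
      ultimately show ?thesis
        using mat_norm_triangle[of "- (D ((D ^^ n) ?G) x - D Z x)" "D ((D ^^ n) ?G) x - Z x"] by simp
    qed
    moreover have "(\<lambda>n. rho ^ Suc n * 4) \<longlonglongrightarrow> 0 * 4"
      using rho_less_1 rho_nonneg by (intro tendsto_intros LIMSEQ_Suc LIMSEQ_realpow_zero) auto
    ultimately have "mat_norm (D Z x - Z x) \<le> 0"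
      by (intro LIMSEQ_le_const[where X="\<lambda>n. rho ^ Suc n * 4"]) auto
    then have "norm (D Z x - Z x) \<le> 0"
      using norm_le_card_mat_norm[of "D Z x - Z x"] mat_norm_nonneg[of "D Z x - Z x"] by simp
    then show ?thesis by simp
  qed
  moreover have "D Z x = Z x" if "\<not> 0 \<le> x" for x
    using Z_ext that by (simp add: first_jump_op_def extensional_def)
  ultimately show ?thesis by blast
qed

end

end

section \<open>Conditioning on the past of an exponential clock\<close>

text \<open>The hypothesis \<open>gt\<close> says that, given the past \<open>F\<close> on
  \<open>A\<close>, the clock \<open>T\<close> is exponential with rate \<open>l\<close> and
  \<open>L\<close> occurs independently with probability \<open>q\<close>. So the law of
  \<open>(V, T)\<close> on \<open>A \<inter> L\<close> is a product: \<open>q\<close> times the law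
  of \<open>V\<close> on \<open>A\<close>, and the exponential law. Fubini gives the claim. In the
  application \<open>A\<close> fixes the current phase and \<open>L\<close> the next one.\<close>

lemma (in prob_space) integral_exponential_clock:
  fixes T :: "'a \<Rightarrow> real" and h :: "'b \<times> real \<Rightarrow> real"
  assumes F: "subalgebra M F" and T[measurable]: "T \<in> borel_measurable M"
    and T_pos: "\<And>\<omega>. \<omega> \<in> space M \<Longrightarrow> 0 < T \<omega>"
    and L[measurable]: "L \<in> events" and A: "A \<in> sets F" and l: "0 < l" and q: "0 \<le> q"
    and gt: "\<And>B s. B \<in> sets F \<Longrightarrow> 0 \<le> s \<Longrightarrow>
      prob (B \<inter> A \<inter> L \<inter> {\<omega> \<in> space M. s < T \<omega>}) = q * exp (- l * s) * prob (B \<inter> A)"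
    and V: "V \<in> F \<rightarrow>\<^sub>M N" and h[measurable]: "h \<in> borel_measurable (N \<Otimes>\<^sub>M borel)"
    and bnd: "\<And>z. \<bar>h z\<bar> \<le> C"
  shows "(\<integral>\<omega>. indicator (A \<inter> L) \<omega> * h (V \<omega>, T \<omega>) \<partial>M) =
    q * (\<integral>\<omega>. indicator A \<omega> * (\<integral>t. exponential_density l t * h (V \<omega>, t) \<partial>lborel) \<partial>M)"
proof -
  have A'[measurable]: "A \<in> events" using A F by (auto simp: subalgebra_def)
  have V'[measurable]: "V \<in> M \<rightarrow>\<^sub>M N" using measurable_from_subalg[OF F V] .
  \<comment> \<open>Here \<open>D\<close> is the exponential law, not the first-jump
    operator.\<close>
  define D where "D = density lborel (exponential_density l)"
  interpret D: prob_space D unfolding D_def by (rule prob_space_exponential_density[OF l])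
  have setsD[measurable_cong, simp]: "sets D = sets borel" by (simp add: D_def)
  have D_gt: "measure D {s<..} = exp (- s * l)" if "0 \<le> s" for s
  proof -
    have "distributed D lborel (\<lambda>x. x) (exponential_density l)"
      unfolding distributed_def by (auto simp: D_def distr_id2)
    from D.exponential_distributedD_gt[OF this that l]
    have "measure D {x \<in> space D. s < x} = exp (- s * l)" .
    also have "{x \<in> space D. s < x} = {s<..}" by (auto simp: D_def)
    finally show ?thesis .
  qed
  \<comment> \<open>\<open>MV\<close> is \<open>q\<close> times the law of \<open>V\<close> on
    \<open>A\<close>; \<open>M2\<close> is the joint law of \<open>V\<close> and \<open>T\<close> on
    \<open>A \<inter> L\<close>.\<close>
  define M1 where "M1 = density M (\<lambda>\<omega>. q * indicator A \<omega>)"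
  define MV where "MV = distr M1 N V"
  define M2 where "M2 = distr (density M (\<lambda>\<omega>. ennreal (indicator (A \<inter> L) \<omega>))) (N \<Otimes>\<^sub>M borel) (\<lambda>\<omega>. (V \<omega>, T \<omega>))"
  have V1: "V \<in> M1 \<rightarrow>\<^sub>M N" by (simp add: M1_def)
  have fin1: "finite_measure M1"
  proof
    have "emeasure M1 (space M1) = (\<integral>\<^sup>+\<omega>. ennreal (q * indicator A \<omega>) \<partial>M)"
      by (simp add: M1_def emeasure_density)
    also have "\<dots> \<le> (\<integral>\<^sup>+\<omega>. ennreal q \<partial>M)"
      by (intro nn_integral_mono) (auto simp: indicator_def q)
    finally show "emeasure M1 (space M1) \<noteq> \<infinity>" by (auto simp: emeasure_space_1 top_unique)
  qed
  then interpret MV: finite_measure MV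
    unfolding MV_def by (rule finite_measure.finite_measure_distr[OF _ V1])
  interpret P: pair_sigma_finite MV D ..
  have eq: "MV \<Otimes>\<^sub>M D = M2"
  proof (rule pair_measure_eqI)
    show "sigma_finite_measure MV" "sigma_finite_measure D" by unfold_locales
    show "sets (MV \<Otimes>\<^sub>M D) = sets M2" by (simp add: MV_def M2_def cong: sets_pair_measure_cong)
    fix B C assume "B \<in> sets MV" and C: "C \<in> sets D"
    then have B[measurable]: "B \<in> sets N" by (simp add: MV_def)
    define VB where "VB = V -` B \<inter> space M"
    have VB: "VB \<in> sets F" using measurable_sets[OF V B] F by (simp add: VB_def subalgebra_def)
    have VB'[measurable]: "VB \<in> events" by (simp add: VB_def)
    \<comment> \<open>With \<open>B\<close> fixed, both sides are measures in \<open>C\<close>. They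
      agree on open half-lines, an intersection-stable generator of the Borel sets, where
      \<open>gt\<close> gives the tail.\<close>
    define \<mu> where "\<mu> = distr (density M (indicator (VB \<inter> A \<inter> L))) borel T"
    define \<nu> where "\<nu> = scale_measure (ennreal (q * prob (VB \<inter> A))) D"
    have em_\<mu>: "emeasure \<mu> C = emeasure M (VB \<inter> A \<inter> L \<inter> (T -` C \<inter> space M))" if [measurable]: "C \<in> sets borel" for C
    proof -
      have "emeasure \<mu> C = (\<integral>\<^sup>+\<omega>. indicator (VB \<inter> A \<inter> L) \<omega> * indicator (T -` C \<inter> space M) \<omega> \<partial>M)"
        by (simp add: \<mu>_def emeasure_distr emeasure_density)
      also have "\<dots> = (\<integral>\<^sup>+\<omega>. indicator (VB \<inter> A \<inter> L \<inter> (T -` C \<inter> space M)) \<omega> \<partial>M)"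
        by (intro nn_integral_cong) (auto simp: indicator_def)
      finally show ?thesis by (simp add: nn_integral_indicator)
    qed
    have "\<mu> = \<nu>"
    proof (rule measure_eqI_generator_eq[where E="range greaterThan" and \<Omega>=UNIV and A="\<lambda>n. {- real n<..}"])
      have "{a<..} \<inter> {b<..} = {max a b<..}" for a b :: real by auto
      then show "Int_stable (range (greaterThan :: real \<Rightarrow> _))"
        by (auto simp: Int_stable_def)
      show "sets \<mu> = sigma_sets UNIV (range greaterThan)" "sets \<nu> = sigma_sets UNIV (range greaterThan)"
        by (simp_all add: \<mu>_def \<nu>_def borel_Ioi)
      show "(\<Union>i. {- real i<..}) = UNIV"
        by (auto intro: reals_Archimedean2 simp: minus_less_iff)
      show "emeasure \<mu> {- real i<..} \<noteq> \<infinity>" for i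
        by (simp add: em_\<mu>)
      fix X :: "real set" assume "X \<in> range greaterThan"
      then obtain s where X: "X = {s<..}" by auto
      \<comment> \<open>\<open>gt\<close> covers only nonnegative thresholds. Below zero nothing
        changes: \<open>T\<close> is positive and the exponential law gives full mass to the
        positive half-line.\<close>
      define s' where "s' = max 0 s"
      have s'_nn: "0 \<le> s'" by (simp add: s'_def)
      have eqT: "T -` {s<..} \<inter> space M = {\<omega> \<in> space M. s' < T \<omega>}"
        using T_pos by (fastforce simp: s'_def)
      have eqD: "emeasure D {s<..} = emeasure D {s'<..}"
      proof (cases "s < 0")
        case True
        have "emeasure D {0<..} = 1" using D_gt[of 0] by (simp add: D.emeasure_eq_measure)
        moreover have "emeasure D {0<..} \<le> emeasure D {s<..}"
          using True by (intro emeasure_mono) auto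
        ultimately have "emeasure D {s<..} = 1"
          using D.emeasure_le_1 by (metis antisym)
        with \<open>emeasure D {0<..} = 1\<close> True show ?thesis by (simp add: s'_def)
      qed (simp add: s'_def)
      have "emeasure \<mu> X = ennreal (q * exp (- l * s') * prob (VB \<inter> A))"
        using gt[OF VB s'_nn] by (simp add: X em_\<mu> eqT emeasure_eq_measure)
      also have "\<dots> = emeasure \<nu> X"
        using eqD D_gt[of s'] s'_nn
        by (simp add: X \<nu>_def D.emeasure_eq_measure ennreal_mult[symmetric] q mult_ac)
      finally show "emeasure \<mu> X = emeasure \<nu> X" .
    qed auto
    have "emeasure M2 (B \<times> C) = emeasure \<mu> C"
    proof -
      have [measurable]: "C \<in> sets borel" using C by simp
      have "emeasure M2 (B \<times> C) = (\<integral>\<^sup>+\<omega>. ennreal (indicator (A \<inter> L) \<omega>) * indicator ((\<lambda>\<omega>. (V \<omega>, T \<omega>)) -` (B \<times> C) \<inter> space M) \<omega> \<partial>M)"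
        by (simp add: M2_def emeasure_distr emeasure_density)
      also have "\<dots> = (\<integral>\<^sup>+\<omega>. indicator (VB \<inter> A \<inter> L \<inter> (T -` C \<inter> space M)) \<omega> \<partial>M)"
        by (intro nn_integral_cong) (auto simp: indicator_def VB_def)
      also have "\<dots> = emeasure \<mu> C"
        by (simp add: nn_integral_indicator em_\<mu>)
      finally show ?thesis .
    qed
    also have "\<dots> = emeasure MV B * emeasure D C"
    proof -
      have "emeasure MV B = (\<integral>\<^sup>+\<omega>. ennreal (q * indicator A \<omega>) * indicator VB \<omega> \<partial>M)"
        by (simp add: MV_def M1_def emeasure_distr emeasure_density VB_def)
      also have "\<dots> = (\<integral>\<^sup>+\<omega>. ennreal q * indicator (VB \<inter> A) \<omega> \<partial>M)"
        by (intro nn_integral_cong) (auto simp: indicator_def)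
      also have "\<dots> = ennreal q * ennreal (prob (VB \<inter> A))"
        by (simp add: nn_integral_cmult emeasure_eq_measure)
      finally show ?thesis
        using q by (simp add: \<open>\<mu> = \<nu>\<close> \<nu>_def ennreal_mult)
    qed
    finally show "emeasure MV B * emeasure D C = emeasure M2 (B \<times> C)" by simp
  qed
  have h': "h \<in> borel_measurable (MV \<Otimes>\<^sub>M D)"
    using h by (simp add: MV_def cong: measurable_cong_sets sets_pair_measure_cong)
  have "(\<integral>\<omega>. indicator (A \<inter> L) \<omega> * h (V \<omega>, T \<omega>) \<partial>M) = (\<integral>z. h z \<partial>M2)"
    by (simp add: M2_def integral_distr integral_density)
  also have "\<dots> = (\<integral>z. h z \<partial>(MV \<Otimes>\<^sub>M D))" by (simp add: eq)
  also have "\<dots> = (\<integral>v. (\<integral>t. h (v, t) \<partial>D) \<partial>MV)"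
  proof (rule P.integral_fst'[symmetric])
    interpret PF: finite_measure "MV \<Otimes>\<^sub>M D"
      by (rule finite_measure_pair_measure) unfold_locales
    show "integrable (MV \<Otimes>\<^sub>M D) h"
      using h' bnd by (intro PF.integrable_const_bound[where B=C]) auto
  qed
  also have "\<dots> = (\<integral>v. (\<integral>t. exponential_density l t * h (v, t) \<partial>lborel) \<partial>MV)"
  proof (rule Bochner_Integration.integral_cong[OF refl])
    fix v assume "v \<in> space MV"
    then have "v \<in> space N" by (simp add: MV_def)
    then have "(\<lambda>t. h (v, t)) \<in> borel_measurable lborel" by measurable
    then show "(\<integral>t. h (v, t) \<partial>D) = (\<integral>t. exponential_density l t * h (v, t) \<partial>lborel)"
      using l by (simp add: D_def integral_density exponential_density_nonneg)
  qed
  also have "\<dots> = (\<integral>\<omega>. q * indicator A \<omega> * (\<integral>t. exponential_density l t * h (V \<omega>, t) \<partial>lborel) \<partial>M)"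
    using q by (simp add: MV_def M1_def integral_distr integral_density)
  finally show ?thesis by (simp add: mult.assoc)
qed

section \<open>The embedded jump chain\<close>

text \<open>Levels at the jumps, recomputed from jump times and phases alone. This gives a chain
  with an exact starting level and shows which holding times each level depends on.\<close>

primrec level :: "('m \<Rightarrow> real) \<Rightarrow> ('m \<Rightarrow> real) \<Rightarrow> real \<Rightarrow> (nat \<Rightarrow> real) \<Rightarrow> (nat \<Rightarrow> 'm) \<Rightarrow> nat \<Rightarrow> real" where
  "level p c x s k 0 = x"
| "level p c x s k (Suc n) = p (k n) * (level p c x s k n + (s (Suc n) - s n) / c (k n))"

lemma level_nonneg:
  assumes "\<And>i. 0 < p i \<and> p i < 1" "\<And>i. c i > 0" "0 \<le> x" "\<And>n. s n < s (Suc n)"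
  shows "0 \<le> level p c x s k n"
proof (induction n)
  case (Suc n)
  then show ?case using assms(1,2)[of "k n"] assms(4)[of n] by simp
qed (use assms in simp)

text \<open>The hypotheses concern only indices below \<open>n\<close>; this makes level
  \<open>n\<close> measurable with respect to the past of jump \<open>n\<close>, which does not
  contain the next holding time.\<close>

lemma measurable_level:
  fixes K :: "nat \<Rightarrow> 'w \<Rightarrow> 'm::finite"
  assumes "x \<in> borel_measurable N" "\<And>m. m < n \<Longrightarrow> (\<lambda>\<omega>. S (Suc m) \<omega> - S m \<omega>) \<in> borel_measurable N"
    "\<And>m. m < n \<Longrightarrow> K m \<in> N \<rightarrow>\<^sub>M count_space UNIV"
  shows "(\<lambda>\<omega>. level p c (x \<omega>) (\<lambda>m. S m \<omega>) (\<lambda>m. K m \<omega>) n) \<in> borel_measurable N"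
  using assms(2,3)
proof (induction n)
  case (Suc n)
  note [measurable] = Suc.prems(1)[of n, simplified] Suc.prems(2)[of n, simplified] Suc.IH[OF Suc.prems, simplified]
  show ?case by simp
qed (use assms(1) in simp)

text \<open>The discounted value of \<open>G\<close> at jump \<open>min n N\<close>.\<close>

primrec payoff :: "real \<Rightarrow> real \<Rightarrow> (real \<Rightarrow> real^'m^'m) \<Rightarrow> 'm::finite \<Rightarrow>
    (nat \<Rightarrow> real) \<Rightarrow> (nat \<Rightarrow> 'm) \<Rightarrow> (nat \<Rightarrow> real) \<Rightarrow> nat \<Rightarrow> real" where
  "payoff w b G j s k y 0 = exp (- w * s 0) * G (y 0) $ k 0 $ j"
| "payoff w b G j s k y (Suc n) =
    (if \<exists>m\<le>n. y m \<le> b then payoff w b G j s k y n else exp (- w * s (Suc n)) * G (y (Suc n)) $ k (Suc n) $ j)"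

text \<open>The bound on \<open>m\<close> is strict: without a stop before \<open>n\<close>, the
  payoff reads the value at jump \<open>n\<close> whether or not that level is above
  \<open>b\<close>.\<close>

lemma payoff_alive:
  "\<forall>m<n. b < y m \<Longrightarrow> payoff w b G j s k y n = exp (- w * s n) * G (y n) $ k n $ j"
  by (cases n) (auto simp: less_Suc_eq_le not_le)

lemma payoff_stopped:
  assumes "m \<le> n" "y m \<le> b"
  shows "payoff w b G j s k y n = payoff w b G j s k y m"
  using assms(1)
proof (induction n rule: dec_induct)
  case (step n)
  then show ?case using assms(2) by auto
qed simp

text \<open>At the stopping level \<open>G\<close> is the identity, so after stopping the payoff no
  longer depends on \<open>G\<close>. On stopped paths \<open>G\<close> may thus be exchanged for
  its image under the operator.\<close>

lemma payoff_eq_at_Least: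
  assumes G: "G \<in> passage_funs b" and y: "\<And>m. 0 \<le> y m" and m: "m \<le> n" "y m \<le> b"
  defines "N \<equiv> LEAST m. y m \<le> b"
  shows "payoff w b G j s k y n = exp (- w * s N) * of_bool (k N = j)"
proof -
  have N: "y N \<le> b" "N \<le> m" unfolding N_def using m(2) by (auto intro: LeastI Least_le)
  have "\<forall>m<N. b < y m" unfolding N_def by (auto dest: not_less_Least simp: not_le)
  then have "payoff w b G j s k y N = exp (- w * s N) * G (y N) $ k N $ j" by (rule payoff_alive)
  moreover have "payoff w b G j s k y n = payoff w b G j s k y N"
    using N m by (intro payoff_stopped) auto
  ultimately show ?thesis
    using passage_funs_eq_mat1[OF G y N(1)] by (simp add: mat_def)
qed

lemma abs_payoff_le:
  assumes w: "0 < w" and B: "\<And>x. 0 \<le> x \<Longrightarrow> mat_norm (G x) \<le> B" and y: "\<And>m. 0 \<le> y m" and s: "\<And>m. 0 \<le> s m"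
  shows "\<bar>payoff w b G j s k y n\<bar> \<le> B"
proof -
  have *: "\<bar>exp (- w * s n) * G (y n) $ k n $ j\<bar> \<le> B" for n
  proof -
    have "exp (- w * s n) \<le> 1" using w s by simp
    moreover have "\<bar>G (y n) $ k n $ j\<bar> \<le> B" using abs_entry_le_mat_norm B[OF y] order_trans by blast
    ultimately have "exp (- w * s n) * \<bar>G (y n) $ k n $ j\<bar> \<le> 1 * B" by (intro mult_mono) auto
    then show ?thesis by (simp add: abs_mult)
  qed
  show ?thesis
  proof (induction n)
    case (Suc n)
    then show ?case using *[of "Suc n"] by simp
  qed (use *[of 0] in simp)
qed

text \<open>If some level is at most \<open>b\<close>, the payoff is eventually constant; otherwise
  the discount tends to zero along the diverging jump times while \<open>G\<close> stays bounded.
  The limit is the same for all \<open>G\<close>.\<close>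

lemma payoff_tendsto:
  assumes w: "0 < w" and G: "G \<in> passage_funs b" and y: "\<And>m. 0 \<le> y m" and s: "filterlim s at_top sequentially"
  defines "N \<equiv> LEAST m. y m \<le> b"
  shows "payoff w b G j s k y \<longlonglongrightarrow> (if \<exists>m. y m \<le> b then exp (- w * s N) * of_bool (k N = j) else 0)"
proof (cases "\<exists>m. y m \<le> b")
  case True
  then obtain m where "y m \<le> b" by blast
  then have "\<forall>\<^sub>F n in sequentially. payoff w b G j s k y n = exp (- w * s N) * of_bool (k N = j)"
    unfolding N_def using payoff_eq_at_Least[where y=y, OF G y]
    by (intro eventually_sequentiallyI[of m]) blast
  then show ?thesis using True by (simp add: tendsto_eventually)
next
  case False
  obtain B where B: "\<And>x. 0 \<le> x \<Longrightarrow> mat_norm (G x) \<le> B" using passage_funs_bound[OF G] by blast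
  have "(\<lambda>n. exp (- w * s n)) \<longlonglongrightarrow> 0"
    using filterlim_tendsto_pos_mult_at_top[OF tendsto_const w s]
    by (intro filterlim_compose[OF exp_at_bot]) (simp add: filterlim_uminus_at_bot)
  then have lim: "(\<lambda>n. exp (- w * s n) * B) \<longlonglongrightarrow> 0" by (rule tendsto_mult_left_zero)
  have bound: "norm (payoff w b G j s k y n) \<le> exp (- w * s n) * B" for n
  proof -
    have "payoff w b G j s k y n = exp (- w * s n) * G (y n) $ k n $ j"
      using False by (intro payoff_alive) (simp add: not_le)
    moreover have "\<bar>G (y n) $ k n $ j\<bar> \<le> B" using abs_entry_le_mat_norm B[OF y] order_trans by blast
    ultimately show ?thesis by (simp add: abs_mult)
  qed
  have "payoff w b G j s k y \<longlonglongrightarrow> 0"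
    by (rule Lim_null_comparison[OF always_eventually[OF allI[OF bound]] lim])
  then show ?thesis using False by simp
qed

text \<open>The row index is random, so the entry is written as a finite sum over phases of entries
  with a fixed index.\<close>

lemma measurable_entry_compose:
  fixes K :: "'w \<Rightarrow> 'm::finite"
  assumes G: "G \<in> passage_funs b" and [measurable]: "K \<in> N \<rightarrow>\<^sub>M count_space UNIV" "Y \<in> borel_measurable N"
    and Y: "\<And>\<omega>. \<omega> \<in> space N \<Longrightarrow> 0 \<le> Y \<omega>"
  shows "(\<lambda>\<omega>. G (Y \<omega>) $ K \<omega> $ j) \<in> borel_measurable N"
proof -
  note [measurable] = measurable_entry0[OF G]
  have "(\<lambda>\<omega>. \<Sum>a\<in>UNIV. (if K \<omega> = a then entry0 G a j (Y \<omega>) else 0)) \<in> borel_measurable N"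
    by measurable
  then show ?thesis
    by (rule measurable_cong[THEN iffD1, rotated]) (simp add: entry0_eq Y)
qed

lemma measurable_payoff:
  assumes G: "G \<in> passage_funs b" and [measurable]: "\<And>n. S n \<in> borel_measurable N"
    "\<And>n. K n \<in> N \<rightarrow>\<^sub>M count_space UNIV" "\<And>n. Y n \<in> borel_measurable N"
    and Y: "\<And>n \<omega>. \<omega> \<in> space N \<Longrightarrow> 0 \<le> Y n \<omega>"
  shows "(\<lambda>\<omega>. payoff w b G j (\<lambda>n. S n \<omega>) (\<lambda>n. K n \<omega>) (\<lambda>n. Y n \<omega>) n) \<in> borel_measurable N"
proof -
  have [measurable]: "(\<lambda>\<omega>. G (Y n \<omega>) $ K n \<omega> $ j) \<in> borel_measurable N" for n
    using Y by (intro measurable_entry_compose[OF G]) auto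
  show ?thesis
  proof (induction n)
    case (Suc n)
    note [measurable] = Suc
    show ?case unfolding payoff.simps by measurable
  qed (unfold payoff.simps, measurable)
qed

text \<open>The process reduced to jump times and phases. Starting level and phase are exact on
  every path, whereas \<open>growth_collapse_process\<close> grants them almost surely.\<close>

locale jump_chain = growth_collapse_data c lam p Q w b + prob_space M
  for c lam p :: "'m::finite \<Rightarrow> real" and Q w b and M :: "'w measure" +
  fixes S :: "nat \<Rightarrow> 'w \<Rightarrow> real" and K :: "nat \<Rightarrow> 'w \<Rightarrow> 'm" and x0 :: real and i0 :: 'm
  assumes S_measurable [measurable]: "\<And>n. S n \<in> borel_measurable M"
    and K_measurable [measurable]: "\<And>n. K n \<in> M \<rightarrow>\<^sub>M count_space UNIV"
    and S_0: "\<And>\<omega>. \<omega> \<in> space M \<Longrightarrow> S 0 \<omega> = 0"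
    and S_less: "\<And>n \<omega>. \<omega> \<in> space M \<Longrightarrow> S n \<omega> < S (Suc n) \<omega>"
    and K_0: "\<And>\<omega>. \<omega> \<in> space M \<Longrightarrow> K 0 \<omega> = i0"
    and x0_nonneg: "0 \<le> x0"
    and law: "\<And>n s j. (\<forall>k<n. s k \<ge> 0) \<Longrightarrow> j 0 = i0 \<Longrightarrow>
      prob {\<omega> \<in> space M. \<forall>k<n. S (Suc k) \<omega> - S k \<omega> > s k \<and> K (Suc k) \<omega> = j (Suc k)} =
      (\<Prod>k<n. exp (- lam (j k) * s k) * Q $ j k $ j (Suc k))"
begin

section \<open>Holding times, levels and the past of the chain\<close>

definition T :: "nat \<Rightarrow> 'w \<Rightarrow> real" where "T n \<omega> = S (Suc n) \<omega> - S n \<omega>"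

lemma T_measurable [measurable]: "T n \<in> borel_measurable M"
  unfolding T_def[abs_def] by measurable

lemma T_pos: "\<omega> \<in> space M \<Longrightarrow> 0 < T n \<omega>"
  using S_less by (simp add: T_def)

lemma S_nonneg: "\<omega> \<in> space M \<Longrightarrow> 0 \<le> S n \<omega>"
proof (induction n)
  case (Suc n)
  then show ?case using S_less[of \<omega> n] by simp
qed (simp add: S_0)

definition Y :: "nat \<Rightarrow> 'w \<Rightarrow> real" where
  "Y n \<omega> = level p c x0 (\<lambda>n. S n \<omega>) (\<lambda>n. K n \<omega>) n"

lemma Y_0: "Y 0 \<omega> = x0" by (simp add: Y_def)

lemma Y_Suc: "Y (Suc n) \<omega> = p (K n \<omega>) * (Y n \<omega> + T n \<omega> / c (K n \<omega>))"
  by (simp add: Y_def T_def)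

lemma Y_nonneg: "\<omega> \<in> space M \<Longrightarrow> 0 \<le> Y n \<omega>"
  unfolding Y_def by (intro level_nonneg p_bounds c_pos x0_nonneg S_less)

lemma Y_measurable [measurable]: "Y n \<in> borel_measurable M"
  unfolding Y_def[abs_def] by (intro measurable_level) auto

text \<open>Phases after \<open>n\<close> are replaced by \<open>i0\<close>, so that a history up to
  jump \<open>n\<close> is a function of the kind \<open>law\<close> quantifies over, and only
  finitely many occur.\<close>

definition path :: "nat \<Rightarrow> 'w \<Rightarrow> nat \<Rightarrow> 'm" where
  "path n \<omega> = (\<lambda>k. if k \<le> n then K k \<omega> else i0)"

definition paths :: "nat \<Rightarrow> (nat \<Rightarrow> 'm) set" where
  "paths n = {j. j 0 = i0 \<and> (\<forall>k>n. j k = i0)}"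

text \<open>For a single history in \<open>C\<close> this is the event whose probability
  \<open>law\<close> provides. Thresholds concern the holding times before jump \<open>n\<close>,
  histories the phases up to and including \<open>K n\<close>.\<close>

definition past_event :: "nat \<Rightarrow> (nat \<Rightarrow> real) \<Rightarrow> (nat \<Rightarrow> 'm) set \<Rightarrow> 'w set" where
  "past_event n s C = {\<omega> \<in> space M. (\<forall>k<n. s k < T k \<omega>) \<and> path n \<omega> \<in> C}"

text \<open>The information available just after jump \<open>n\<close>; it includes
  \<open>K n\<close> but not \<open>T n\<close>. Thresholds are nonnegative as in
  \<open>law\<close>.\<close>

definition past :: "nat \<Rightarrow> 'w measure" where
  "past n = sigma (space M) {past_event n s C | s C. \<forall>k. 0 \<le> s k}"

lemma finite_paths: "finite (paths n)"
proof -
  have "finite {j. \<forall>k. (k \<in> {..n} \<longrightarrow> j k \<in> (UNIV :: 'm set)) \<and> (k \<notin> {..n} \<longrightarrow> j k = i0)}"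
    by (intro finite_set_of_finite_funs) auto
  then show ?thesis by (rule rev_finite_subset) (auto simp: paths_def)
qed

lemma path_in_paths: "\<omega> \<in> space M \<Longrightarrow> path n \<omega> \<in> paths n"
  by (simp add: path_def paths_def K_0)

lemma past_event_single:
  assumes "j \<in> paths n"
  shows "past_event n s {j} =
    {\<omega> \<in> space M. \<forall>k<n. S (Suc k) \<omega> - S k \<omega> > s k \<and> K (Suc k) \<omega> = j (Suc k)}"
proof -
  have "path n \<omega> = j \<longleftrightarrow> (\<forall>k<n. K (Suc k) \<omega> = j (Suc k))" if "\<omega> \<in> space M" for \<omega>
  proof
    assume *: "\<forall>k<n. K (Suc k) \<omega> = j (Suc k)"
    show "path n \<omega> = j"
    proof
      fix k show "path n \<omega> k = j k"
        using * assms that by (cases k) (auto simp: path_def paths_def K_0 Suc_le_eq)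
    qed
  qed (auto simp: path_def)
  then show ?thesis by (auto simp: past_event_def T_def)
qed

lemma past_event_Union: "past_event n s C = (\<Union>j\<in>C \<inter> paths n. past_event n s {j})"
  using path_in_paths by (auto simp: past_event_def)

lemma past_event_single_measurable: "j \<in> paths n \<Longrightarrow> past_event n s {j} \<in> events"
  by (simp add: past_event_single)

lemma past_event_measurable: "past_event n s C \<in> events"
  by (subst past_event_Union) (auto intro!: sets.finite_UN past_event_single_measurable simp: finite_paths)

lemma prob_past_event: "prob (past_event n s C) = (\<Sum>j\<in>C \<inter> paths n. prob (past_event n s {j}))"
proof -
  have "disjoint_family_on (\<lambda>j. past_event n s {j}) (C \<inter> paths n)"
    by (auto simp: disjoint_family_on_def past_event_def)
  then show ?thesis
    unfolding past_event_Union[of n s C]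
    by (intro finite_measure_finite_Union finite_Int disjI2 finite_paths) (auto intro: past_event_single_measurable)
qed

lemma all_less_Suc_upd: "(\<forall>k<Suc n. (s(n := t)) k < f k) \<longleftrightarrow> (\<forall>k<n. s k < f k) \<and> t < f n"
  for t :: real
  by (auto simp: less_Suc_eq)

text \<open>Appending \<open>t\<close> to the thresholds and \<open>l\<close> to the history adds
  one factor to the product in \<open>law\<close>, that of index \<open>n\<close>. Summing over the
  histories in \<open>C\<close> with phase \<open>a\<close> at \<open>n\<close> gives the
  claim.\<close>

lemma prob_past_event_next:
  assumes s: "\<forall>k. 0 \<le> s k" and t: "0 \<le> t"
  shows "prob (past_event n s C \<inter> {\<omega> \<in> space M. K n \<omega> = a} \<inter> {\<omega> \<in> space M. K (Suc n) \<omega> = l} \<inter> {\<omega> \<in> space M. t < T n \<omega>}) =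
    Q $ a $ l * exp (- lam a * t) * prob (past_event n s C \<inter> {\<omega> \<in> space M. K n \<omega> = a})"
proof -
  let ?C = "C \<inter> {j. j n = a}" and ?s = "s(n := t)" and ?f = "\<lambda>j. j(Suc n := l)"
  \<comment> \<open>Members of \<open>paths n\<close> all take the value \<open>i0\<close> at
    \<open>Suc n\<close>, so overwriting that place loses nothing.\<close>
  have inj: "inj_on ?f (?C \<inter> paths n)"
  proof (rule inj_onI)
    fix j j' assume j: "j \<in> ?C \<inter> paths n" and j': "j' \<in> ?C \<inter> paths n" and eq: "?f j = ?f j'"
    show "j = j'"
    proof
      fix k show "j k = j' k"
        using fun_cong[OF eq, of k] j j' by (cases "k = Suc n") (auto simp: paths_def)
    qed
  qed
  have "past_event n s C \<inter> {\<omega> \<in> space M. K n \<omega> = a} \<inter> {\<omega> \<in> space M. K (Suc n) \<omega> = l} \<inter> {\<omega> \<in> space M. t < T n \<omega>} =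
    past_event (Suc n) ?s (?f ` (?C \<inter> paths n))" (is "?L = ?R")
  proof (rule set_eqI)
    fix \<omega>
    show "\<omega> \<in> ?L \<longleftrightarrow> \<omega> \<in> ?R"
    proof (cases "\<omega> \<in> space M")
      case \<omega>: True
      have Suc_path: "path (Suc n) \<omega> = (path n \<omega>)(Suc n := K (Suc n) \<omega>)"
        by (auto simp: path_def fun_eq_iff)
      have "path (Suc n) \<omega> \<in> ?f ` (?C \<inter> paths n) \<longleftrightarrow> path n \<omega> \<in> ?C \<and> K (Suc n) \<omega> = l"
      proof
        assume "path (Suc n) \<omega> \<in> ?f ` (?C \<inter> paths n)"
        then obtain j where j: "j \<in> ?C \<inter> paths n" "(path n \<omega>)(Suc n := K (Suc n) \<omega>) = ?f j"
          by (auto simp: Suc_path)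
        have "path n \<omega> = j"
        proof
          fix k show "path n \<omega> k = j k"
            using fun_cong[OF j(2), of k] j(1) by (cases "k = Suc n") (auto simp: paths_def path_def)
        qed
        then show "path n \<omega> \<in> ?C \<and> K (Suc n) \<omega> = l"
          using j(1) fun_cong[OF j(2), of "Suc n"] by simp
      next
        assume "path n \<omega> \<in> ?C \<and> K (Suc n) \<omega> = l"
        then show "path (Suc n) \<omega> \<in> ?f ` (?C \<inter> paths n)"
          using path_in_paths[OF \<omega>, of n] by (auto simp: Suc_path)
      qed
      moreover have "path n \<omega> n = K n \<omega>" by (simp add: path_def)
      ultimately show ?thesis using \<omega>
        unfolding past_event_def by (simp only: all_less_Suc_upd mem_Collect_eq Int_iff) blast
    qed (simp add: past_event_def)
  qed
  moreover have "past_event n s C \<inter> {\<omega> \<in> space M. K n \<omega> = a} = past_event n s ?C"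
    by (auto simp: past_event_def path_def)
  moreover have "prob (past_event (Suc n) ?s (?f ` (?C \<inter> paths n))) =
      Q $ a $ l * exp (- lam a * t) * prob (past_event n s ?C)"
  proof -
    have f_paths: "?f j \<in> paths (Suc n)" if "j \<in> paths n" for j
      using that by (auto simp: paths_def)
    have single: "prob (past_event (Suc n) ?s {?f j}) = Q $ a $ l * exp (- lam a * t) * prob (past_event n s {j})"
      if j: "j \<in> ?C \<inter> paths n" for j
    proof -
      have "prob (past_event (Suc n) ?s {?f j}) =
          (\<Prod>k<Suc n. exp (- lam (?f j k) * ?s k) * Q $ ?f j k $ ?f j (Suc k))"
        using j s t f_paths by (subst past_event_single, simp, intro law) (auto simp: paths_def)
      also have "\<dots> = (\<Prod>k<n. exp (- lam (j k) * s k) * Q $ j k $ j (Suc k)) * (exp (- lam a * t) * Q $ a $ l)"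
        using j by simp
      also have "(\<Prod>k<n. exp (- lam (j k) * s k) * Q $ j k $ j (Suc k)) = prob (past_event n s {j})"
        using j s by (subst past_event_single, simp, intro law[symmetric]) (auto simp: paths_def)
      finally show ?thesis by (simp only: mult_ac)
    qed
    have "?f ` (?C \<inter> paths n) \<inter> paths (Suc n) = ?f ` (?C \<inter> paths n)"
      using f_paths by auto
    then have "prob (past_event (Suc n) ?s (?f ` (?C \<inter> paths n))) =
        (\<Sum>j\<in>?C \<inter> paths n. prob (past_event (Suc n) ?s {?f j}))"
      by (subst prob_past_event) (simp add: sum.reindex[OF inj])
    also have "\<dots> = Q $ a $ l * exp (- lam a * t) * prob (past_event n s ?C)"
      unfolding prob_past_event[of n s ?C] sum_distrib_left using single by (intro sum.cong) auto
    finally show ?thesis .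
  qed
  ultimately show ?thesis by simp
qed

lemma past_sets: "sets (past n) = sigma_sets (space M) {past_event n s C | s C. \<forall>k. 0 \<le> s k}"
  and past_space [simp]: "space (past n) = space M"
proof -
  have *: "{past_event n s C | s C. \<forall>k. 0 \<le> s k} \<subseteq> Pow (space M)" by (auto simp: past_event_def)
  show "sets (past n) = sigma_sets (space M) {past_event n s C | s C. \<forall>k. 0 \<le> s k}"
    using * by (simp add: past_def)
  show "space (past n) = space M" using * by (simp add: past_def space_measure_of)
qed

lemma past_subalgebra: "subalgebra M (past n)"
  unfolding subalgebra_def past_sets
  by (auto intro!: sets.sigma_sets_subset past_event_measurable)

lemma past_event_in_past: "\<forall>k. 0 \<le> s k \<Longrightarrow> past_event n s C \<in> sets (past n)"
  unfolding past_sets by auto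

text \<open>Dynkin's lemma: the identity holds on the generators, which are closed under
  intersection by taking the maximum of the thresholds, and both sides are countably additive in
  \<open>B\<close>.\<close>

lemma prob_past_next:
  assumes B: "B \<in> sets (past n)" and t: "0 \<le> t"
  shows "prob (B \<inter> {\<omega> \<in> space M. K n \<omega> = a} \<inter> {\<omega> \<in> space M. K (Suc n) \<omega> = l} \<inter> {\<omega> \<in> space M. t < T n \<omega>}) =
    Q $ a $ l * exp (- lam a * t) * prob (B \<inter> {\<omega> \<in> space M. K n \<omega> = a})"
proof -
  let ?E = "{past_event n s C | s C. \<forall>k. 0 \<le> s k}"
  define A where "A = {\<omega> \<in> space M. K n \<omega> = a}"
  define A' where "A' = A \<inter> {\<omega> \<in> space M. K (Suc n) \<omega> = l} \<inter> {\<omega> \<in> space M. t < T n \<omega>}"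
  have [measurable]: "A \<in> events" "A' \<in> events" by (auto simp: A_def A'_def)
  have sub: "B \<in> events" if "B \<in> sigma_sets (space M) ?E" for B
    using that past_subalgebra[of n] by (auto simp: subalgebra_def past_sets)
  have "past_event n s C \<inter> past_event n s' C' = past_event n (\<lambda>k. max (s k) (s' k)) (C \<inter> C')" for s s' C C'
    by (auto simp: past_event_def)
  then have stable: "Int_stable ?E"
    unfolding Int_stable_def by (clarsimp, intro exI conjI) (rule refl, simp add: le_max_iff_disj)
  have closed: "?E \<subseteq> Pow (space M)" by (auto simp: past_event_def)
  have "prob (B \<inter> A') = Q $ a $ l * exp (- lam a * t) * prob (B \<inter> A)"
    using stable closed B[unfolded past_sets]
  proof (induct rule: sigma_sets_induct_disjoint)
    case (basic B)
    then show ?case using prob_past_event_next[OF _ t] by (auto simp: A_def A'_def Int_assoc)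
  next
    case (compl B)
    note [measurable] = sub[OF compl(1)]
    \<comment> \<open>Complements need the identity for the whole space, which is itself a generator
      because holding times are positive.\<close>
    have "space M = past_event n (\<lambda>_. 0) UNIV" using T_pos by (auto simp: past_event_def)
    then have whole: "prob (space M \<inter> A') = Q $ a $ l * exp (- lam a * t) * prob (space M \<inter> A)"
      using prob_past_event_next[OF _ t, of "\<lambda>_. 0" n UNIV a l] by (simp add: A_def A'_def Int_assoc)
    have "prob ((space M - B) \<inter> H) = prob (space M \<inter> H) - prob (B \<inter> H)" if [measurable]: "H \<in> events" for H
    proof -
      have "(space M - B) \<inter> H = space M \<inter> H - B \<inter> H" by blast
      moreover have "B \<inter> H \<subseteq> space M \<inter> H" using sets.sets_into_space[OF sub[OF compl(1)]] by blast
      ultimately show ?thesis by (simp add: finite_measure_Diff)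
    qed
    then show ?case using compl(2) whole by (simp add: right_diff_distrib)
  next
    case (union B)
    have [measurable]: "B n \<in> events" for n using union(2) sub by blast
    have "(\<lambda>n. prob (B n \<inter> H)) sums prob ((\<Union>n. B n) \<inter> H)" if [measurable]: "H \<in> events" for H
    proof -
      have "(\<lambda>n. prob (B n \<inter> H)) sums prob (\<Union>n. B n \<inter> H)"
        using union(1) by (intro finite_measure_UNION) (auto simp: disjoint_family_on_def)
      then show ?thesis by simp
    qed
    note lim = this
    have "prob (B n \<inter> A') = Q $ a $ l * exp (- lam a * t) * prob (B n \<inter> A)" for n
      using union(3) by blast
    then have "(\<lambda>n. prob (B n \<inter> A')) sums (Q $ a $ l * exp (- lam a * t) * prob ((\<Union>n. B n) \<inter> A))"
      using sums_mult[OF lim[of A], of "Q $ a $ l * exp (- lam a * t)"] by simp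
    with lim[of A'] show ?case by (simp add: sums_unique2)
  qed simp_all
  then show ?thesis by (simp add: A_def A'_def Int_assoc)
qed

lemma K_measurable_past: "m \<le> n \<Longrightarrow> K m \<in> past n \<rightarrow>\<^sub>M count_space UNIV"
proof -
  assume "m \<le> n"
  \<comment> \<open>Zero thresholds impose nothing on positive holding times; only the phase
    condition remains.\<close>
  then have "K m -` {a} \<inter> space M = past_event n (\<lambda>_. 0) {j. j m = a}" for a
    using T_pos by (auto simp: past_event_def path_def)
  then show ?thesis by (simp add: measurable_count_space_eq2 past_event_in_past)
qed

lemma T_measurable_past: "m < n \<Longrightarrow> T m \<in> borel_measurable (past n)"
  unfolding borel_measurable_iff_greater
proof (intro allI)
  fix a assume "m < n"
  \<comment> \<open>One threshold at \<open>m\<close>, zero elsewhere; \<open>max 0 a\<close> makes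
    it nonnegative without changing the event.\<close>
  have "{\<omega> \<in> space (past n). a < T m \<omega>} = past_event n ((\<lambda>_. 0)(m := max 0 a)) UNIV"
    using T_pos \<open>m < n\<close> by (auto simp: past_event_def intro: less_trans)
  then show "{\<omega> \<in> space (past n). a < T m \<omega>} \<in> sets (past n)"
    by (simp add: past_event_in_past)
qed

lemma Y_measurable_past: "m \<le> n \<Longrightarrow> Y m \<in> borel_measurable (past n)"
  unfolding Y_def[abs_def]
  by (intro measurable_level K_measurable_past T_measurable_past[unfolded T_def[abs_def]]) auto

lemma S_measurable_past: "S n \<in> borel_measurable (past n)"
proof -
  have "S n \<omega> = (\<Sum>m<n. T m \<omega>)" if "\<omega> \<in> space M" for \<omega>
    using S_0[OF that] by (induction n) (simp_all add: T_def)
  then show ?thesis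
    by (subst measurable_cong[where g="\<lambda>\<omega>. \<Sum>m<n. T m \<omega>"])
       (auto intro!: borel_measurable_sum T_measurable_past)
qed

end

text \<open>The common limit of the payoffs in \<open>payoff_tendsto\<close>, in a form that does
  not mention \<open>G\<close>.\<close>

definition passage_value :: "real \<Rightarrow> real \<Rightarrow> 'm \<Rightarrow> (nat \<Rightarrow> real) \<Rightarrow> (nat \<Rightarrow> 'm) \<Rightarrow> (nat \<Rightarrow> real) \<Rightarrow> real" where
  "passage_value w b j s k y = (if \<exists>m. y m \<le> b
     then exp (- w * s (LEAST m. y m \<le> b)) * of_bool (k (LEAST m. y m \<le> b) = j) else 0)"

text \<open>The first index with level at most \<open>b\<close> is not treated directly: the value
  is a pointwise limit of measurable payoffs, for which \<open>G\<close> is an auxiliary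
  witness.\<close>

lemma measurable_passage_value:
  fixes K :: "nat \<Rightarrow> 'w \<Rightarrow> 'm::finite" and G :: "real \<Rightarrow> real^'m^'m"
  assumes w: "0 < w" and G: "G \<in> passage_funs b"
    and meas: "\<And>n. S n \<in> borel_measurable N" "\<And>n. K n \<in> N \<rightarrow>\<^sub>M count_space UNIV" "\<And>n. Y n \<in> borel_measurable N"
    and Y: "\<And>n \<omega>. \<omega> \<in> space N \<Longrightarrow> 0 \<le> Y n \<omega>"
    and S: "\<And>\<omega>. \<omega> \<in> space N \<Longrightarrow> filterlim (\<lambda>n. S n \<omega>) at_top sequentially"
  shows "(\<lambda>\<omega>. passage_value w b j (\<lambda>n. S n \<omega>) (\<lambda>n. K n \<omega>) (\<lambda>n. Y n \<omega>)) \<in> borel_measurable N"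
proof (rule borel_measurable_LIMSEQ_real)
  show "(\<lambda>\<omega>. payoff w b G j (\<lambda>n. S n \<omega>) (\<lambda>n. K n \<omega>) (\<lambda>n. Y n \<omega>) n) \<in> borel_measurable N" for n
    by (rule measurable_payoff[OF G meas Y])
  show "payoff w b G j (\<lambda>n. S n \<omega>) (\<lambda>n. K n \<omega>) (\<lambda>n. Y n \<omega>) \<longlonglongrightarrow>
      passage_value w b j (\<lambda>n. S n \<omega>) (\<lambda>n. K n \<omega>) (\<lambda>n. Y n \<omega>)" if "\<omega> \<in> space N" for \<omega>
    unfolding passage_value_def by (intro payoff_tendsto w G Y S that)
qed

section \<open>Iterates of the operator as expected stopped payoffs\<close>

context jump_chain
begin

definition alive :: "nat \<Rightarrow> 'w set" where
  "alive n = {\<omega> \<in> space M. \<forall>m\<le>n. b < Y m \<omega>}"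

lemma alive_measurable [measurable]: "alive n \<in> events"
  unfolding alive_def by measurable

lemma alive_in_past: "alive n \<in> sets (past n)"
proof -
  have "{\<omega> \<in> space (past n). \<forall>m\<in>{..n}. b < Y m \<omega>} \<in> sets (past n)"
  proof (rule sets.sets_Collect_finite_All')
    fix m assume "m \<in> {..n}"
    then have [measurable]: "Y m \<in> borel_measurable (past n)" by (simp add: Y_measurable_past)
    show "{\<omega> \<in> space (past n). b < Y m \<omega>} \<in> sets (past n)" by measurable
  qed auto
  moreover have "alive n = {\<omega> \<in> space (past n). \<forall>m\<in>{..n}. b < Y m \<omega>}"
    by (auto simp: alive_def)
  ultimately show ?thesis by (simp only:)
qed

lemma integrable_bounded_by:
  fixes f :: "'w \<Rightarrow> real"
  assumes "f \<in> borel_measurable M" "\<And>\<omega>. \<omega> \<in> space M \<Longrightarrow> \<bar>f \<omega>\<bar> \<le> C"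
  shows "integrable M f"
  using assms by (intro integrable_const_bound[where B=C]) auto

text \<open>Split by the current phase \<open>a\<close> and the next phase \<open>l\<close>, the
  value at the next jump is a function of \<open>(S n, Y n)\<close>, known to the past, and of
  \<open>T n\<close>. Integrating out \<open>T n\<close> leaves
  \<open>Q $ a $ l * discounted a (entry0 G l j)\<close> at \<open>Y n\<close>, and summing over
  \<open>l\<close> gives the entry \<open>(a, j)\<close> of \<open>D G\<close>.\<close>

lemma integral_one_step:
  assumes G: "G \<in> passage_funs b"
  shows "(\<integral>\<omega>. indicator (alive n) \<omega> * (exp (- w * S (Suc n) \<omega>) * G (Y (Suc n) \<omega>) $ K (Suc n) \<omega> $ j) \<partial>M) =
    (\<integral>\<omega>. indicator (alive n) \<omega> * (exp (- w * S n \<omega>) * D G (Y n \<omega>) $ K n \<omega> $ j) \<partial>M)"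
proof -
  obtain B where B: "\<And>x. 0 \<le> x \<Longrightarrow> mat_norm (G x) \<le> B" using passage_funs_bound[OF G] by blast
  note [measurable] = measurable_entry0[OF G]
  define A where "A a = alive n \<inter> {\<omega> \<in> space M. K n \<omega> = a}" for a
  define L where "L l = {\<omega> \<in> space M. K (Suc n) \<omega> = l}" for l
  \<comment> \<open>\<open>max 0\<close> bounds \<open>h\<close> everywhere, as
    \<open>integral_exponential_clock\<close> requires; \<open>S n\<close> and \<open>T n\<close>
    are nonnegative, so actual values are unaffected.\<close>
  define h where "h a l z = exp (- w * max 0 (fst (fst z))) * exp (- w * max 0 (snd z)) *
    entry0 G l j (p a * (snd (fst z) + snd z / c a))" for a l z
  define V where "V \<omega> = (S n \<omega>, Y n \<omega>)" for \<omega>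
  have A_past: "A a \<in> sets (past n)" for a
  proof -
    have "K n -` {a} \<inter> space (past n) \<in> sets (past n)"
      by (rule measurable_sets[OF K_measurable_past]) auto
    moreover have "A a = alive n \<inter> (K n -` {a} \<inter> space (past n))" by (auto simp: A_def)
    ultimately show ?thesis using alive_in_past by auto
  qed
  have [measurable]: "A a \<in> events" "L l \<in> events" for a l by (auto simp: A_def L_def)
  have V_past: "V \<in> past n \<rightarrow>\<^sub>M borel \<Otimes>\<^sub>M borel"
    unfolding V_def[abs_def] by (intro measurable_Pair S_measurable_past Y_measurable_past) simp
  have [measurable]: "V \<in> M \<rightarrow>\<^sub>M borel \<Otimes>\<^sub>M borel"
    unfolding V_def[abs_def] by measurable
  have h_meas[measurable]: "h a l \<in> borel_measurable ((borel \<Otimes>\<^sub>M borel) \<Otimes>\<^sub>M borel)" for a l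
    unfolding h_def[abs_def] by measurable
  have h_bound: "\<bar>h a l z\<bar> \<le> B" for a l z
  proof -
    have "exp (- w * max 0 (fst (fst z))) * exp (- w * max 0 (snd z)) \<le> 1 * 1"
      using w_pos by (intro mult_mono) auto
    then have "exp (- w * max 0 (fst (fst z))) * exp (- w * max 0 (snd z)) *
        \<bar>entry0 G l j (p a * (snd (fst z) + snd z / c a))\<bar> \<le> 1 * B"
      using entry0_le[OF B] by (intro mult_mono) auto
    then show ?thesis by (simp add: h_def abs_mult)
  qed
  have step: "(\<integral>\<omega>. indicator (A a \<inter> L l) \<omega> * h a l (V \<omega>, T n \<omega>) \<partial>M) =
      Q $ a $ l * (\<integral>\<omega>. indicator (A a) \<omega> * (exp (- w * S n \<omega>) * discounted a (entry0 G l j) (Y n \<omega>)) \<partial>M)" for a l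
  proof -
    have "prob (E \<inter> A a \<inter> L l \<inter> {\<omega> \<in> space M. s < T n \<omega>}) = Q $ a $ l * exp (- lam a * s) * prob (E \<inter> A a)"
      if "E \<in> sets (past n)" "0 \<le> s" for E s
      using prob_past_next[OF sets.Int[OF that(1) alive_in_past] that(2), of a l]
      by (simp add: A_def L_def Int_assoc)
    from integral_exponential_clock[OF past_subalgebra T_measurable T_pos _ A_past lam_pos Q_nonneg this V_past h_meas h_bound]
    have "(\<integral>\<omega>. indicator (A a \<inter> L l) \<omega> * h a l (V \<omega>, T n \<omega>) \<partial>M) =
      Q $ a $ l * (\<integral>\<omega>. indicator (A a) \<omega> * (\<integral>t. exponential_density (lam a) t * h a l (V \<omega>, t) \<partial>lborel) \<partial>M)"
      by simp
    moreover have "(\<integral>t. exponential_density (lam a) t * h a l (V \<omega>, t) \<partial>lborel) =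
        exp (- w * S n \<omega>) * discounted a (entry0 G l j) (Y n \<omega>)" if \<omega>: "\<omega> \<in> space M" for \<omega>
    proof -
      \<comment> \<open>The density of rate \<open>lam a\<close> and the discount at rate
        \<open>w\<close> merge into \<open>disc a\<close>.\<close>
      have "exponential_density (lam a) t * h a l (V \<omega>, t) =
          exp (- w * S n \<omega>) * (disc a t * entry0 G l j (p a * (Y n \<omega> + t / c a)))" for t
      proof (cases "t < 0")
        case False
        have "exp (- (w + lam a) * t) = exp (- t * lam a) * exp (- w * t)"
          by (simp add: exp_add[symmetric] algebra_simps)
        then show ?thesis using False S_nonneg[OF \<omega>, of n]
          by (simp add: exponential_density_def h_def disc_def V_def)
      qed (simp add: exponential_density_def disc_def)
      then show ?thesis by (simp add: discounted_def)
    qed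
    ultimately show ?thesis
      by (simp cong: Bochner_Integration.integral_cong)
  qed
  have "(\<integral>\<omega>. indicator (alive n) \<omega> * (exp (- w * S (Suc n) \<omega>) * G (Y (Suc n) \<omega>) $ K (Suc n) \<omega> $ j) \<partial>M) =
      (\<integral>\<omega>. (\<Sum>a\<in>UNIV. \<Sum>l\<in>UNIV. indicator (A a \<inter> L l) \<omega> * h a l (V \<omega>, T n \<omega>)) \<partial>M)"
  proof (rule Bochner_Integration.integral_cong[OF refl])
    fix \<omega> assume \<omega>: "\<omega> \<in> space M"
    have "(\<Sum>a\<in>UNIV. \<Sum>l\<in>UNIV. indicator (A a \<inter> L l) \<omega> * h a l (V \<omega>, T n \<omega>)) =
        (\<Sum>a\<in>UNIV. if K n \<omega> = a then (\<Sum>l\<in>UNIV. if K (Suc n) \<omega> = l then indicator (alive n) \<omega> * h a l (V \<omega>, T n \<omega>) else 0) else 0)"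
      using \<omega> by (intro sum.cong refl) (auto simp: A_def L_def indicator_def intro!: sum.cong sum.neutral)
    also have "\<dots> = indicator (alive n) \<omega> * h (K n \<omega>) (K (Suc n) \<omega>) (V \<omega>, T n \<omega>)"
      by simp
    also have "h (K n \<omega>) (K (Suc n) \<omega>) (V \<omega>, T n \<omega>) = exp (- w * S (Suc n) \<omega>) * G (Y (Suc n) \<omega>) $ K (Suc n) \<omega> $ j"
    proof -
      have "exp (- w * S (Suc n) \<omega>) = exp (- w * S n \<omega>) * exp (- w * T n \<omega>)"
        by (simp add: exp_add[symmetric] T_def algebra_simps)
      then show ?thesis
        using S_nonneg[OF \<omega>, of n] T_pos[OF \<omega>, of n] entry0_eq[OF Y_nonneg[OF \<omega>, of "Suc n"], of G "K (Suc n) \<omega>" j]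
        by (simp add: h_def V_def Y_Suc)
    qed
    finally show "indicator (alive n) \<omega> * (exp (- w * S (Suc n) \<omega>) * G (Y (Suc n) \<omega>) $ K (Suc n) \<omega> $ j) =
        (\<Sum>a\<in>UNIV. \<Sum>l\<in>UNIV. indicator (A a \<inter> L l) \<omega> * h a l (V \<omega>, T n \<omega>))" by simp
  qed
  also have "\<dots> = (\<Sum>a\<in>UNIV. \<Sum>l\<in>UNIV. \<integral>\<omega>. indicator (A a \<inter> L l) \<omega> * h a l (V \<omega>, T n \<omega>) \<partial>M)"
  proof -
    have "integrable M (\<lambda>\<omega>. indicator (A a \<inter> L l) \<omega> * h a l (V \<omega>, T n \<omega>))" for a l
      using h_bound[of a l] order_trans[OF abs_ge_zero h_bound]
      by (intro integrable_bounded_by[where C=B]) (measurable, auto simp: indicator_def)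
    then show ?thesis by (simp only: Bochner_Integration.integral_sum Bochner_Integration.integrable_sum)
  qed
  also have "\<dots> = (\<Sum>a\<in>UNIV. \<Sum>l\<in>UNIV. \<integral>\<omega>. Q $ a $ l * (indicator (A a) \<omega> * (exp (- w * S n \<omega>) * discounted a (entry0 G l j) (Y n \<omega>))) \<partial>M)"
    by (simp add: step)
  also have "\<dots> = (\<integral>\<omega>. (\<Sum>a\<in>UNIV. \<Sum>l\<in>UNIV. Q $ a $ l * (indicator (A a) \<omega> * (exp (- w * S n \<omega>) * discounted a (entry0 G l j) (Y n \<omega>)))) \<partial>M)"
  proof -
    have [measurable]: "discounted a (entry0 G l j) \<in> borel_measurable borel" for a l
      by (intro measurable_discounted) measurable
    have "integrable M (\<lambda>\<omega>. Q $ a $ l * (indicator (A a) \<omega> * (exp (- w * S n \<omega>) * discounted a (entry0 G l j) (Y n \<omega>))))" for a l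
    proof (intro integrable_mult_right integrable_bounded_by)
      fix \<omega> assume \<omega>: "\<omega> \<in> space M"
      have "\<bar>discounted a (entry0 G l j) (Y n \<omega>)\<bar> \<le> lam a / (w + lam a) * B"
        using entry0_le[OF B] by (intro order_trans[OF discounted_abs_le discounted_le]) auto
      moreover have "exp (- w * S n \<omega>) \<le> 1" using w_pos S_nonneg[OF \<omega>, of n] by simp
      ultimately have "exp (- w * S n \<omega>) * \<bar>discounted a (entry0 G l j) (Y n \<omega>)\<bar> \<le> 1 * (lam a / (w + lam a) * B)"
        by (intro mult_mono) auto
      then have "exp (- w * S n \<omega>) * \<bar>discounted a (entry0 G l j) (Y n \<omega>)\<bar> \<le> \<bar>lam a / (w + lam a) * B\<bar>"
        by linarith
      then show "\<bar>indicator (A a) \<omega> * (exp (- w * S n \<omega>) * discounted a (entry0 G l j) (Y n \<omega>))\<bar> \<le> \<bar>lam a / (w + lam a) * B\<bar>"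
        by (simp add: indicator_def abs_mult del: abs_divide)
    qed measurable
    then show ?thesis by (simp only: Bochner_Integration.integral_sum Bochner_Integration.integrable_sum)
  qed
  also have "\<dots> = (\<integral>\<omega>. indicator (alive n) \<omega> * (exp (- w * S n \<omega>) * D G (Y n \<omega>) $ K n \<omega> $ j) \<partial>M)"
  proof (rule Bochner_Integration.integral_cong[OF refl])
    fix \<omega> assume \<omega>: "\<omega> \<in> space M"
    have "(\<Sum>a\<in>UNIV. \<Sum>l\<in>UNIV. Q $ a $ l * (indicator (A a) \<omega> * (exp (- w * S n \<omega>) * discounted a (entry0 G l j) (Y n \<omega>)))) =
      (\<Sum>a\<in>UNIV. if K n \<omega> = a then indicator (alive n) \<omega> * (exp (- w * S n \<omega>) * (\<Sum>l\<in>UNIV. Q $ a $ l * discounted a (entry0 G l j) (Y n \<omega>))) else 0)"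
      using \<omega> by (intro sum.cong refl) (auto simp: A_def indicator_def sum_distrib_left mult_ac)
    also have "\<dots> = indicator (alive n) \<omega> * (exp (- w * S n \<omega>) * (\<Sum>l\<in>UNIV. Q $ K n \<omega> $ l * discounted (K n \<omega>) (entry0 G l j) (Y n \<omega>)))"
      by simp
    \<comment> \<open>Survival gives \<open>b < Y n\<close>, the case in which \<open>D G\<close> is
      an integral; elsewhere the indicator is zero.\<close>
    also have "\<dots> = indicator (alive n) \<omega> * (exp (- w * S n \<omega>) * D G (Y n \<omega>) $ K n \<omega> $ j)"
      by (auto simp: indicator_def alive_def D_gt)
    finally show "(\<Sum>a\<in>UNIV. \<Sum>l\<in>UNIV. Q $ a $ l * (indicator (A a) \<omega> * (exp (- w * S n \<omega>) * discounted a (entry0 G l j) (Y n \<omega>)))) =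
      indicator (alive n) \<omega> * (exp (- w * S n \<omega>) * D G (Y n \<omega>) $ K n \<omega> $ j)" .
  qed
  finally show ?thesis .
qed

abbreviation stopped :: "(real \<Rightarrow> real^'m^'m) \<Rightarrow> 'm \<Rightarrow> nat \<Rightarrow> 'w \<Rightarrow> real" where
  "stopped G j n \<omega> \<equiv> payoff w b G j (\<lambda>n. S n \<omega>) (\<lambda>n. K n \<omega>) (\<lambda>n. Y n \<omega>) n"

lemma stopped_measurable: "G \<in> passage_funs b \<Longrightarrow> stopped G j n \<in> borel_measurable M"
  by (intro measurable_payoff Y_nonneg) auto

lemma abs_stopped_le:
  assumes "\<And>x. 0 \<le> x \<Longrightarrow> mat_norm (G x) \<le> B" "\<omega> \<in> space M"
  shows "\<bar>stopped G j n \<omega>\<bar> \<le> B"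
  using assms by (intro abs_payoff_le w_pos Y_nonneg S_nonneg)

lemma integral_stopped:
  assumes "G \<in> passage_funs b"
  shows "(\<integral>\<omega>. stopped G j n \<omega> \<partial>M) = (D ^^ n) G x0 $ i0 $ j"
  using assms
proof (induction n arbitrary: G)
  case 0
  have "(\<integral>\<omega>. stopped G j 0 \<omega> \<partial>M) = (\<integral>\<omega>. G x0 $ i0 $ j \<partial>M)"
    by (intro Bochner_Integration.integral_cong) (simp_all add: S_0 K_0 Y_0)
  then show ?case by (simp add: prob_space)
next
  case (Suc n)
  note G = Suc.prems and DG = D_passage_funs[OF Suc.prems]
  obtain B where B: "\<And>x. 0 \<le> x \<Longrightarrow> mat_norm (G x) \<le> B" using passage_funs_bound[OF G] by blast
  have B': "\<And>x. 0 \<le> x \<Longrightarrow> mat_norm (D G x) \<le> B" by (rule mat_norm_D_le[OF G B])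
  \<comment> \<open>Stopped paths contribute the same for \<open>G\<close> and \<open>D G\<close>.
    Their part is written with \<open>D G\<close> from the outset and stays fixed while the
    surviving part takes one step.\<close>
  define dead where "dead \<omega> = indicator (space M - alive n) \<omega> * stopped (D G) j n \<omega>" for \<omega>
  have not_alive: "stopped G j n \<omega> = stopped (D G) j n \<omega>" if "\<omega> \<in> space M" "\<omega> \<notin> alive n" for \<omega>
  proof -
    have "\<exists>m\<le>n. Y m \<omega> \<le> b" using that by (auto simp: alive_def not_less)
    then obtain m where "m \<le> n" "Y m \<omega> \<le> b" by blast
    then show ?thesis
      using payoff_eq_at_Least[OF G, of "\<lambda>m. Y m \<omega>"] payoff_eq_at_Least[OF DG, of "\<lambda>m. Y m \<omega>"] Y_nonneg[OF that(1)]
      by metis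
  qed
  have dead_int: "integrable M dead"
  proof (rule integrable_bounded_by[where C=B])
    show "dead \<in> borel_measurable M"
      unfolding dead_def[abs_def] using stopped_measurable[OF DG] by measurable
    show "\<bar>dead \<omega>\<bar> \<le> B" if "\<omega> \<in> space M" for \<omega>
      using abs_stopped_le[of "D G", OF B' that, of j n] by (auto simp: dead_def indicator_def)
  qed
  have entry_int: "integrable M (\<lambda>\<omega>. indicator (alive n) \<omega> * (exp (- w * S m \<omega>) * H (Y m \<omega>) $ K m \<omega> $ j))"
    if H: "H \<in> passage_funs b" and HB: "\<And>x. 0 \<le> x \<Longrightarrow> mat_norm (H x) \<le> B" for H m
  proof (rule integrable_bounded_by[where C=B])
    have [measurable]: "(\<lambda>\<omega>. H (Y m \<omega>) $ K m \<omega> $ j) \<in> borel_measurable M"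
      using Y_nonneg by (intro measurable_entry_compose[OF H]) auto
    show "(\<lambda>\<omega>. indicator (alive n) \<omega> * (exp (- w * S m \<omega>) * H (Y m \<omega>) $ K m \<omega> $ j)) \<in> borel_measurable M"
      by measurable
    fix \<omega> assume \<omega>: "\<omega> \<in> space M"
    have "exp (- w * S m \<omega>) \<le> 1" using w_pos S_nonneg[OF \<omega>, of m] by simp
    moreover have "\<bar>H (Y m \<omega>) $ K m \<omega> $ j\<bar> \<le> B"
      using abs_entry_le_mat_norm HB[OF Y_nonneg[OF \<omega>]] order_trans by blast
    ultimately have "exp (- w * S m \<omega>) * \<bar>H (Y m \<omega>) $ K m \<omega> $ j\<bar> \<le> 1 * B" by (intro mult_mono) auto
    moreover have "0 \<le> B" using HB[of 0] mat_norm_nonneg[of "H 0"] by simp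
    ultimately show "\<bar>indicator (alive n) \<omega> * (exp (- w * S m \<omega>) * H (Y m \<omega>) $ K m \<omega> $ j)\<bar> \<le> B"
      by (auto simp: indicator_def abs_mult)
  qed
  have "(\<integral>\<omega>. stopped G j (Suc n) \<omega> \<partial>M) =
      (\<integral>\<omega>. dead \<omega> + indicator (alive n) \<omega> * (exp (- w * S (Suc n) \<omega>) * G (Y (Suc n) \<omega>) $ K (Suc n) \<omega> $ j) \<partial>M)"
  proof (rule Bochner_Integration.integral_cong[OF refl])
    fix \<omega> assume \<omega>: "\<omega> \<in> space M"
    then have "\<omega> \<in> alive n \<longleftrightarrow> \<not> (\<exists>m\<le>n. Y m \<omega> \<le> b)"
      by (simp add: alive_def) (meson not_le)
    then show "stopped G j (Suc n) \<omega> =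
      dead \<omega> + indicator (alive n) \<omega> * (exp (- w * S (Suc n) \<omega>) * G (Y (Suc n) \<omega>) $ K (Suc n) \<omega> $ j)"
      using not_alive[OF \<omega>] \<omega> by (cases "\<omega> \<in> alive n") (auto simp: dead_def)
  qed
  also have "\<dots> = (\<integral>\<omega>. dead \<omega> \<partial>M) + (\<integral>\<omega>. indicator (alive n) \<omega> * (exp (- w * S (Suc n) \<omega>) * G (Y (Suc n) \<omega>) $ K (Suc n) \<omega> $ j) \<partial>M)"
    by (rule Bochner_Integration.integral_add[OF dead_int entry_int[OF G B]])
  also have "\<dots> = (\<integral>\<omega>. dead \<omega> \<partial>M) + (\<integral>\<omega>. indicator (alive n) \<omega> * (exp (- w * S n \<omega>) * D G (Y n \<omega>) $ K n \<omega> $ j) \<partial>M)"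
    by (simp only: integral_one_step[OF G])
  also have "\<dots> = (\<integral>\<omega>. dead \<omega> + indicator (alive n) \<omega> * (exp (- w * S n \<omega>) * D G (Y n \<omega>) $ K n \<omega> $ j) \<partial>M)"
    by (rule Bochner_Integration.integral_add[OF dead_int entry_int[OF DG B'], symmetric])
  also have "\<dots> = (\<integral>\<omega>. stopped (D G) j n \<omega> \<partial>M)"
  proof (rule Bochner_Integration.integral_cong[OF refl])
    fix \<omega> assume \<omega>: "\<omega> \<in> space M"
    show "dead \<omega> + indicator (alive n) \<omega> * (exp (- w * S n \<omega>) * D G (Y n \<omega>) $ K n \<omega> $ j) = stopped (D G) j n \<omega>"
    proof (cases "\<omega> \<in> alive n")
      case True
      then have "stopped (D G) j n \<omega> = exp (- w * S n \<omega>) * D G (Y n \<omega>) $ K n \<omega> $ j"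
        by (intro payoff_alive) (auto simp: alive_def)
      then show ?thesis using True by (simp add: dead_def)
    qed (use \<omega> in \<open>simp add: dead_def\<close>)
  qed
  also have "\<dots> = (D ^^ Suc n) G x0 $ i0 $ j"
    by (simp only: Suc.IH[OF DG] funpow_Suc_right comp_apply)
  finally show ?case .
qed

text \<open>Dominated convergence: a bound on \<open>G\<close> bounds all stopped payoffs, whose
  expectations are the iterates by \<open>integral_stopped\<close>.\<close>

lemma funpow_D_tendsto:
  assumes G: "G \<in> passage_funs b" and S: "\<And>\<omega>. \<omega> \<in> space M \<Longrightarrow> filterlim (\<lambda>n. S n \<omega>) at_top sequentially"
  shows "(\<lambda>n. (D ^^ n) G x0 $ i0 $ j) \<longlonglongrightarrow>
    (\<integral>\<omega>. passage_value w b j (\<lambda>n. S n \<omega>) (\<lambda>n. K n \<omega>) (\<lambda>n. Y n \<omega>) \<partial>M)"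
proof -
  obtain B where B: "\<And>x. 0 \<le> x \<Longrightarrow> mat_norm (G x) \<le> B" using passage_funs_bound[OF G] by blast
  show ?thesis
    unfolding integral_stopped[OF G, symmetric]
  proof (rule integral_dominated_convergence)
  show "integrable M (\<lambda>_. B)" by simp
  show "AE \<omega> in M. norm (stopped G j n \<omega>) \<le> B" for n
    using abs_stopped_le[OF B] by (auto intro!: AE_I2)
  show "stopped G j n \<in> borel_measurable M" for n by (rule stopped_measurable[OF G])
  show "(\<lambda>\<omega>. passage_value w b j (\<lambda>n. S n \<omega>) (\<lambda>n. K n \<omega>) (\<lambda>n. Y n \<omega>)) \<in> borel_measurable M"
    by (rule measurable_passage_value[OF w_pos G]) (auto intro: Y_nonneg S)
  show "AE \<omega> in M. (\<lambda>n. stopped G j n \<omega>) \<longlonglongrightarrow> passage_value w b j (\<lambda>n. S n \<omega>) (\<lambda>n. K n \<omega>) (\<lambda>n. Y n \<omega>)"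
    unfolding passage_value_def by (intro AE_I2 payoff_tendsto w_pos G Y_nonneg S)
  qed
qed

end

section \<open>The passage time\<close>

text \<open>Slopes are positive, so a level at most \<open>b\<close> at time \<open>t\<close> was
  already at most \<open>b\<close> at the last jump up to \<open>t\<close>. Hence the infimum is
  attained at a jump time. Index 0 counts as one, which covers a start at or below
  \<open>b\<close>.\<close>

lemma down_time_integrand_eq_passage_value:
  fixes s :: "nat \<Rightarrow> real"
  assumes c: "\<And>i. c i > 0" and s_0: "s 0 = 0" and s_less: "\<And>n. s n < s (Suc n)"
    and s_lim: "filterlim s at_top sequentially"
    and path: "\<And>n t. s n \<le> t \<Longrightarrow> t < s (Suc n) \<Longrightarrow>
      J t \<omega> = k n \<and> X t \<omega> = X (s n) \<omega> + (t - s n) / c (k n)"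
  shows "(if down_time X b \<omega> = \<infinity> then 0
      else exp (- w * real_of_ereal (down_time X b \<omega>)) * of_bool (J (real_of_ereal (down_time X b \<omega>)) \<omega> = j)) =
    passage_value w b j s k (\<lambda>n. X (s n) \<omega>)"
proof -
  have mono: "mono s" using s_less by (simp add: incseq_Suc_iff less_imp_le)
  have below_at_jump: "\<exists>n. s n \<le> t \<and> X (s n) \<omega> \<le> b" if "0 \<le> t" "X t \<omega> \<le> b" for t
  proof -
    obtain m where m: "t < s m"
      using s_lim eventually_happens[of "\<lambda>m. t < s m" sequentially] by (auto simp: filterlim_at_top_dense)
    \<comment> \<open>The last jump up to \<open>t\<close> precedes the first one after
      \<open>t\<close>; the latter has a nonzero index because \<open>s 0 = 0\<close>.\<close>
    define M where "M = (LEAST m. t < s m)"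
    have M: "t < s M" "\<And>m. m < M \<Longrightarrow> \<not> t < s m"
      unfolding M_def using m by (auto intro: LeastI dest: not_less_Least)
    then have "M \<noteq> 0" using s_0 that(1) by (metis not_less)
    then obtain n where "M = Suc n" by (cases M) auto
    with M have n: "s n \<le> t" "t < s (Suc n)" by (auto simp: not_less)
    have "0 \<le> (t - s n) / c (k n)" using n c[of "k n"] by simp
    then show ?thesis using path[OF n] that(2) n by (intro exI[of _ n]) auto
  qed
  show ?thesis
  proof (cases "\<exists>m. X (s m) \<omega> \<le> b")
    case True
    define N where "N = (LEAST m. X (s m) \<omega> \<le> b)"
    have N: "X (s N) \<omega> \<le> b" unfolding N_def using True by (rule LeastI_ex)
    have "0 \<le> s N" using monoD[OF mono, of 0 N] s_0 by simp
    have "down_time X b \<omega> = ereal (s N)"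
      unfolding down_time_def
    proof (rule antisym)
      show "(INF t\<in>{t. 0 \<le> t \<and> X t \<omega> \<le> b}. ereal t) \<le> ereal (s N)"
        using N \<open>0 \<le> s N\<close> by (intro INF_lower) simp
      show "ereal (s N) \<le> (INF t\<in>{t. 0 \<le> t \<and> X t \<omega> \<le> b}. ereal t)"
      proof (rule INF_greatest)
        fix t assume "t \<in> {t. 0 \<le> t \<and> X t \<omega> \<le> b}"
        then obtain n where n: "s n \<le> t" "X (s n) \<omega> \<le> b" using below_at_jump by auto
        then have "N \<le> n" unfolding N_def by (intro Least_le)
        then show "ereal (s N) \<le> ereal t" using monoD[OF mono, of N n] n by simp
      qed
    qed
    moreover have "J (s N) \<omega> = k N" using path[of N "s N"] s_less by simp
    ultimately show ?thesis using True by (simp add: passage_value_def N_def)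
  next
    case False
    then have "{t. 0 \<le> t \<and> X t \<omega> \<le> b} = {}" using below_at_jump by blast
    then have "down_time X b \<omega> = \<infinity>"
      unfolding down_time_def by (simp only: image_empty Inf_empty top_ereal_def)
    then show ?thesis using False by (simp add: passage_value_def)
  qed
qed

text \<open>Pathwise the integrand of \<open>Z_down\<close> is a passage value along the true
  levels, and almost surely these are the levels of a \<open>jump_chain\<close>.\<close>

lemma (in growth_collapse_data) first_jump_iteration_tendsto_Z_down:
  fixes X :: "real \<Rightarrow> 'w \<Rightarrow> real"
  assumes proc: "growth_collapse_process c lam p Q x i (P x i) X J" and x: "0 \<le> x"
    and G: "G \<in> passage_funs b"
  shows "(\<lambda>n. (D ^^ n) G x $ i $ j) \<longlonglongrightarrow> Z_down P X J w b x $ i $ j"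
proof -
  let ?M = "P x i"
  from proc have prob: "prob_space ?M"
    and XJ_meas: "\<forall>t\<ge>0. X t \<in> borel_measurable ?M \<and> J t \<in> ?M \<rightarrow>\<^sub>M count_space UNIV"
    and X_nonneg: "\<forall>\<omega>\<in>space ?M. \<forall>t\<ge>0. X t \<omega> \<ge> 0"
    and start: "AE \<omega> in ?M. X 0 \<omega> = x \<and> J 0 \<omega> = i"
    unfolding growth_collapse_process_def by - (elim conjE, assumption)+
  from proc obtain S K where meas: "\<forall>n::nat. S n \<in> borel_measurable ?M \<and> K n \<in> ?M \<rightarrow>\<^sub>M count_space UNIV"
    and paths: "\<forall>\<omega>\<in>space ?M. S 0 \<omega> = 0 \<and> (\<forall>n. S n \<omega> < S (Suc n) \<omega>) \<and>
      filterlim (\<lambda>n. S n \<omega>) at_top sequentially \<and>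
      (\<forall>n t. S n \<omega> \<le> t \<and> t < S (Suc n) \<omega> \<longrightarrow>
        J t \<omega> = K n \<omega> \<and> X t \<omega> = X (S n \<omega>) \<omega> + (t - S n \<omega>) / c (K n \<omega>)) \<and>
      (\<forall>n. X (S (Suc n) \<omega>) \<omega> = p (K n \<omega>) * (X (S n \<omega>) \<omega> + (S (Suc n) \<omega> - S n \<omega>) / c (K n \<omega>)))"
    and law: "\<forall>n s j. (\<forall>k<n. s k \<ge> 0) \<and> j 0 = i \<longrightarrow>
      measure ?M {\<omega> \<in> space ?M. \<forall>k<n. S (Suc k) \<omega> - S k \<omega> > s k \<and> K (Suc k) \<omega> = j (Suc k)} =
      (\<Prod>k<n. exp (- lam (j k) * s k) * Q $ j k $ j (Suc k))"
    unfolding growth_collapse_process_def by (elim conjE exE) (rule that)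
  have S_meas: "\<And>n. S n \<in> borel_measurable ?M" and K_meas: "\<And>n. K n \<in> ?M \<rightarrow>\<^sub>M count_space UNIV"
    using meas by auto
  have S_0: "\<And>\<omega>. \<omega> \<in> space ?M \<Longrightarrow> S 0 \<omega> = 0"
    and S_less: "\<And>\<omega> n. \<omega> \<in> space ?M \<Longrightarrow> S n \<omega> < S (Suc n) \<omega>"
    and S_lim: "\<And>\<omega>. \<omega> \<in> space ?M \<Longrightarrow> filterlim (\<lambda>n. S n \<omega>) at_top sequentially"
    and path: "\<And>\<omega> n t. \<omega> \<in> space ?M \<Longrightarrow> S n \<omega> \<le> t \<Longrightarrow> t < S (Suc n) \<omega> \<Longrightarrow>
        J t \<omega> = K n \<omega> \<and> X t \<omega> = X (S n \<omega>) \<omega> + (t - S n \<omega>) / c (K n \<omega>)"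
    and jump: "\<And>\<omega> n. \<omega> \<in> space ?M \<Longrightarrow> X (S (Suc n) \<omega>) \<omega> =
        p (K n \<omega>) * (X (S n \<omega>) \<omega> + (S (Suc n) \<omega> - S n \<omega>) / c (K n \<omega>))"
    using paths by simp_all
  interpret prob_space ?M by (rule prob)
  note [measurable] = S_meas K_meas
  text \<open>The start is \<open>(x, i)\<close> only almost surely; \<open>K'\<close> and the levels \<open>chain.Y\<close> start there on every path.\<close>
  define K' where "K' n \<omega> = (if n = 0 then i else K n \<omega>)" for n \<omega>
  interpret chain: jump_chain c lam p Q w b ?M S K' x i
  proof unfold_locales
    show "K' n \<in> ?M \<rightarrow>\<^sub>M count_space UNIV" for n
      unfolding K'_def[abs_def] by (cases "n = 0") auto
    show "prob {\<omega> \<in> space ?M. \<forall>k<n. s k < S (Suc k) \<omega> - S k \<omega> \<and> K' (Suc k) \<omega> = j (Suc k)} =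
        (\<Prod>k<n. exp (- lam (j k) * s k) * Q $ j k $ j (Suc k))"
      if "\<forall>k<n. 0 \<le> s k" "j 0 = i" for n s j
      using law that by (simp add: K'_def)
  qed (use S_meas S_0 S_less x in \<open>auto simp: K'_def\<close>)
  have X_level: "X (S n \<omega>) \<omega> = level p c (X 0 \<omega>) (\<lambda>n. S n \<omega>) (\<lambda>n. K n \<omega>) n" if "\<omega> \<in> space ?M" for n \<omega>
    using that by (induction n) (simp_all add: S_0 jump)
  have S_nonneg: "0 \<le> S n \<omega>" if "\<omega> \<in> space ?M" for n \<omega>
    using chain.S_nonneg[OF that] .
  \<comment> \<open>\<open>X t\<close> is known to be measurable only for fixed \<open>t\<close>; at
    the random time \<open>S n\<close> measurability comes from the level recursion started at
    \<open>X 0\<close>.\<close>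
  have XS_meas: "(\<lambda>\<omega>. X (S n \<omega>) \<omega>) \<in> borel_measurable ?M" for n
  proof -
    have "(\<lambda>\<omega>. level p c (X 0 \<omega>) (\<lambda>n. S n \<omega>) (\<lambda>n. K n \<omega>) n) \<in> borel_measurable ?M"
      by (intro measurable_level) (use XJ_meas in auto)
    then show ?thesis by (rule measurable_cong[THEN iffD1, rotated]) (simp add: X_level)
  qed
  have "Z_down P X J w b x $ i $ j = (\<integral>\<omega>. passage_value w b j (\<lambda>n. S n \<omega>) (\<lambda>n. K n \<omega>) (\<lambda>n. X (S n \<omega>) \<omega>) \<partial>?M)"
  proof -
    have "Z_down P X J w b x $ i $ j = (\<integral>\<omega>. (if down_time X b \<omega> = \<infinity> then 0
        else exp (- w * real_of_ereal (down_time X b \<omega>)) * of_bool (J (real_of_ereal (down_time X b \<omega>)) \<omega> = j)) \<partial>?M)"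
      using x by (simp add: Z_down_def)
    also have "\<dots> = (\<integral>\<omega>. passage_value w b j (\<lambda>n. S n \<omega>) (\<lambda>n. K n \<omega>) (\<lambda>n. X (S n \<omega>) \<omega>) \<partial>?M)"
    proof (rule Bochner_Integration.integral_cong[OF refl])
      fix \<omega> assume \<omega>: "\<omega> \<in> space ?M"
      show "(if down_time X b \<omega> = \<infinity> then 0
          else exp (- w * real_of_ereal (down_time X b \<omega>)) * of_bool (J (real_of_ereal (down_time X b \<omega>)) \<omega> = j)) =
        passage_value w b j (\<lambda>n. S n \<omega>) (\<lambda>n. K n \<omega>) (\<lambda>n. X (S n \<omega>) \<omega>)"
        by (rule down_time_integrand_eq_passage_value[where s="\<lambda>n. S n \<omega>" and k="\<lambda>n. K n \<omega>" and c=c and X=X and J=J and \<omega>=\<omega>,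
            OF c_pos S_0[OF \<omega>] S_less[OF \<omega>] S_lim[OF \<omega>] path[OF \<omega>]])
    qed
    finally show ?thesis .
  qed
  also have "\<dots> = (\<integral>\<omega>. passage_value w b j (\<lambda>n. S n \<omega>) (\<lambda>n. K' n \<omega>) (\<lambda>n. chain.Y n \<omega>) \<partial>?M)"
  proof (rule integral_cong_AE)
    show "(\<lambda>\<omega>. passage_value w b j (\<lambda>n. S n \<omega>) (\<lambda>n. K n \<omega>) (\<lambda>n. X (S n \<omega>) \<omega>)) \<in> borel_measurable ?M"
      by (rule measurable_passage_value[OF w_pos G S_meas K_meas XS_meas]) (use X_nonneg S_nonneg S_lim in auto)
    show "(\<lambda>\<omega>. passage_value w b j (\<lambda>n. S n \<omega>) (\<lambda>n. K' n \<omega>) (\<lambda>n. chain.Y n \<omega>)) \<in> borel_measurable ?M"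
      by (rule measurable_passage_value[OF w_pos G S_meas chain.K_measurable chain.Y_measurable])
         (auto intro: chain.Y_nonneg S_lim)
    show "AE \<omega> in ?M. passage_value w b j (\<lambda>n. S n \<omega>) (\<lambda>n. K n \<omega>) (\<lambda>n. X (S n \<omega>) \<omega>) =
        passage_value w b j (\<lambda>n. S n \<omega>) (\<lambda>n. K' n \<omega>) (\<lambda>n. chain.Y n \<omega>)"
      using start AE_space
    proof eventually_elim
      case (elim \<omega>)
      \<comment> \<open>Time 0 lies in the first interval, so \<open>K 0\<close> equals
        \<open>J 0\<close>.\<close>
      have "K 0 \<omega> = i"
        using path[OF elim(2), of 0 0] S_less[OF elim(2), of 0] elim by (simp add: S_0)
      then have "(\<lambda>n. K n \<omega>) = (\<lambda>n. K' n \<omega>)" by (auto simp: K'_def)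
      moreover have "(\<lambda>n. X (S n \<omega>) \<omega>) = (\<lambda>n. chain.Y n \<omega>)"
        using elim by (simp add: X_level chain.Y_def calculation)
      ultimately show ?case by simp
    qed
  qed
  finally show ?thesis
    using chain.funpow_D_tendsto[OF G S_lim, of j] by simp
qed

theorem mainTheorem4:
  fixes c lam p :: "'m::finite \<Rightarrow> real"
    and Q :: "real^'m^'m"
    and w b :: real
    and P :: "real \<Rightarrow> 'm \<Rightarrow> 'w measure"
    and X :: "real \<Rightarrow> 'w \<Rightarrow> real"
    and J :: "real \<Rightarrow> 'w \<Rightarrow> 'm"
  assumes "\<And>i. c i > 0"
    and "\<And>i. lam i > 0"
    and "\<And>i. 0 < p i \<and> p i < 1"
    and "\<And>i j. Q $ i $ j \<ge> 0"
    and "\<And>i. (\<Sum>j\<in>UNIV. Q $ i $ j) = 1"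
    and "w > 0"
    and "b > 0"
    and "\<And>x i. x \<ge> 0 \<Longrightarrow> growth_collapse_process c lam p Q x i (P x i) X J"
  shows "first_jump_op c lam p Q w b \<in> passage_funs b \<rightarrow> passage_funs b
    \<and> (\<forall>G1\<in>passage_funs b. \<forall>G2\<in>passage_funs b.
         fun_norm (\<lambda>x. first_jump_op c lam p Q w b G1 x - first_jump_op c lam p Q w b G2 x)
           \<le> (MAX i. lam i / (w + lam i)) * fun_norm (\<lambda>x. G1 x - G2 x))
    \<and> (MAX i. lam i / (w + lam i)) < 1
    \<and> Z_down P X J w b \<in> passage_funs b
    \<and> first_jump_op c lam p Q w b (Z_down P X J w b) = Z_down P X J w b
    \<and> (\<forall>G\<in>passage_funs b. first_jump_op c lam p Q w b G = G \<longrightarrow> G = Z_down P X J w b)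
    \<and> (\<forall>G0\<in>passage_funs b.
         uniform_limit {0..} (\<lambda>n. (first_jump_op c lam p Q w b ^^ n) G0)
           (Z_down P X J w b) sequentially)"
proof -
  interpret growth_collapse_data c lam p Q w b
    by (unfold_locales; rule assms)
  let ?Z = "Z_down P X J w b"
  have ext: "?Z \<in> extensional {0..}" by (simp add: Z_down_def)
  have lim: "(\<lambda>n. (D ^^ n) G x $ i $ j) \<longlonglongrightarrow> ?Z x $ i $ j" if "G \<in> passage_funs b" "0 \<le> x" for G x i j
    by (rule first_jump_iteration_tendsto_Z_down[where P=P and J=J, OF assms(8)[OF that(2)] that(2,1)])
  have Z: "?Z \<in> passage_funs b" by (rule limit_passage_funs[OF ext lim])
  have fixed: "D ?Z = ?Z" by (rule limit_fixed_point[OF ext lim])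
  have "uniform_limit {0..} (\<lambda>n. (D ^^ n) G) ?Z sequentially" if "G \<in> passage_funs b" for G
    by (rule funpow_D_uniform_limit[OF ext lim that])
  then show ?thesis
    using D_passage_funs fun_norm_D_diff_le[unfolded rho_def] rho_less_1[unfolded rho_def] Z fixed
      D_fixed_point_unique[OF _ Z _ fixed]
    by blast
qed

end
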